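(* Let $H$ and $L$ be bialgebras over a field $k$, and let $R: H\otimes L\to L\otimes H$ and $W: L\otimes H\to H\otimes L$ be $k$-linear maps. The following statements are equivalent. 1) $L\,{}_W\!\bowtie_R H$ is a smash biproduct of $L$ and $H$. 2) The following conditions hold for all $l,l'\in L$ and $h,h'\in H$, where $r=R$ and $U=W$ denote further copies of $R$ and $W$: (DP1) $R$ is normal and two-sided multiplicative; (DP2) $W$ is conormal and two-sided comultiplicative; (DP3) $(\varepsilon_L\otimes\varepsilon_H)R=\varepsilon_H\otimes\varepsilon_L$; (DP4) $W(1_L\otimes 1_H)=1_H\otimes 1_L$; (DP5) $W(l\otimes h)=W(l\otimes 1_H)\,W(1_L\otimes h)$; (DP6) $\sum l_{(1)}l'_{(1)}\otimes {}^W1_H\otimes {}^W[l_{(2)}l'_{(2)}]=\sum l_{(1)}\,{}^Rl'_{(1)}\otimes {}^R[{}^W1_H]\,{}^U1_H\otimes {}^Wl_{(2)}\,{}^Ul'_{(2)}$; (DP7) $\sum {}^W[h_{(1)}h'_{(1)}]\otimes {}^W1_L\otimes h_{(2)}h'_{(2)}=\sum {}^Wh_{(1)}\,{}^Uh'_{(1)}\otimes {}^W1_L\,{}^R({}^U1_L)\otimes {}^Rh_{(2)}\,h'_{(2)}$; (DP8) $\sum ({}^Rl)_{(1)}\otimes {}^W[({}^Rh)_{(1)}]\otimes {}^W[({}^Rl)_{(2)}]\otimes ({}^Rh)_{(2)}=\sum {}^Rl_{(1)}\otimes {}^R[{}^Wh_{(1)}]\,{}^U1_H\otimes {}^W1_L\,{}^r({}^Ul_{(2)})\otimes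 {}^rh_{(2)}$.
   Context: All tensor products are over $k$; for an algebra $A$, $m_A$ is the multiplication and $I_A$ the identity; for a coalgebra $C$, $\Delta_C$ and $\varepsilon_C$ are comultiplication and counit, and $\Delta(c)=\sum c_{(1)}\otimes c_{(2)}$ (Sweedler notation). Notation for maps: for $R: H\otimes L\to L\otimes H$ write $R(h\otimes l)=\sum {}^Rl\otimes {}^Rh$, and for $W: L\otimes H\to H\otimes L$ write $W(l\otimes h)=\sum {}^Wh\otimes {}^Wl$. In an expression, the two occurrences of the same superscript letter ($R$, $r$, $W$ or $U$) come from one application of the corresponding map. For example, on the right-hand side of (DP6), one first takes $W(l_{(2)}\otimes 1_H)=\sum {}^W1_H\otimes {}^Wl_{(2)}$ and $W(l'_{(2)}\otimes 1_H)=\sum {}^U1_H\otimes {}^Ul'_{(2)}$, and then $R({}^W1_H\otimes l'_{(1)})=\sum {}^Rl'_{(1)}\otimes {}^R[{}^W1_H]$. In (DP5), the product is taken in the tensor product algebra $H\otimes L$. $R$ is normal if $R(h\otimes 1_L)=1_L\otimes h$ and $R(1_H\otimes l)=l\otimes 1_H$ for all $h\in H$, $l\in L$. $R$ is (two-sided) multiplicative if $$R\circ(m_H\otimes I_L)=(I_L\otimes m_H)\circ(R\otimes I_H)\circ(I_H\otimes R)\quad\text{on } H\otimes H\otimes L,$$ $$R\circ(I_H\otimes m_L)=(m_L\otimes I_H)\circ(I_L\otimes R)\circ(R\otimes I_L)\quad\text{on } H\otimes L\otimes L.$$ $W$ is conormal if $(I_H\otimes\varepsilon_L)W(l\otimes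 h)=\varepsilon_L(l)h$ and $(\varepsilon_H\otimes I_L)W(l\otimes h)=\varepsilon_H(h)l$ for all $l\in L$, $h\in H$. $W$ is (two-sided) comultiplicative if $$(\Delta_H\otimes I_L)\circ W=(I_H\otimes W)\circ(W\otimes I_H)\circ(I_L\otimes\Delta_H),$$ $$(I_H\otimes\Delta_L)\circ W=(W\otimes I_L)\circ(I_L\otimes W)\circ(\Delta_L\otimes I_H).$$ $L\,{}_W\!\bowtie_R H$ is the vector space $L\otimes H$ with multiplication $(m_L\otimes m_H)\circ(I_L\otimes R\otimes I_H)$ and comultiplication $(I_L\otimes W\otimes I_H)\circ(\Delta_L\otimes\Delta_H)$. It is a smash biproduct of $L$ and $H$ if the multiplication is associative with unit $1_L\otimes 1_H$, the comultiplication is coassociative with counit $\varepsilon_L\otimes\varepsilon_H$, and with these structures $L\otimes H$ is a bialgebra. *)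

theory Defs
  imports Complex_Main "HOL-Library.Function_Algebras"
begin

section \<open>Vector spaces and linear maps\<close>

text \<open>
  A tensor product of vector spaces depends on their scalar multiplications, so it is a subspace
  of a type and not a type of its own. For this reason every vector space here is a carrier set
  inside a type with a scalar multiplication, with the addition of the type. Maps are total
  functions, of which only the values on the carrier matter.
\<close>

record ('k, 'v) vec =
  space :: "'v set"
  smul :: "'k \<Rightarrow> 'v \<Rightarrow> 'v"

definition vspace :: "('k::field, 'v::ab_group_add, 'm) vec_scheme \<Rightarrow> bool" where
  "vspace A \<longleftrightarrow> vector_space (smul A) \<and> module.subspace (smul A) (space A)"

definition ground :: "('k::field, 'k) vec" where
  "ground = \<lparr>space = UNIV, smul = (*)\<rparr>"

definition linear_map ::
  "('k::field, 'a::ab_group_add, 'm) vec_scheme \<Rightarrow> ('k, 'b::ab_group_add, 'n) vec_scheme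
    \<Rightarrow> ('a \<Rightarrow> 'b) \<Rightarrow> bool" where
  "linear_map A B f \<longleftrightarrow>
     (\<forall>x\<in>space A. f x \<in> space B) \<and>
     (\<forall>x\<in>space A. \<forall>y\<in>space A. f (x + y) = f x + f y) \<and>
     (\<forall>c. \<forall>x\<in>space A. f (smul A c x) = smul B c (f x))"

definition bilinear_map ::
  "('k::field, 'a::ab_group_add, 'm) vec_scheme \<Rightarrow> ('k, 'b::ab_group_add, 'n) vec_scheme
    \<Rightarrow> ('k, 'c::ab_group_add, 'p) vec_scheme \<Rightarrow> ('a \<Rightarrow> 'b \<Rightarrow> 'c) \<Rightarrow> bool" where
  "bilinear_map A B C f \<longleftrightarrow>
     (\<forall>a\<in>space A. linear_map B C (f a)) \<and>
     (\<forall>b\<in>space B. linear_map A C (\<lambda>a. f a b))"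


section \<open>Tensor products\<close>

text \<open>
  The pure tensor of \<open>a\<close> and \<open>b\<close> is the evaluation at \<open>(a, b)\<close>, as a functional on the bilinear
  forms. The tensor product is the space of finite sums of pure tensors, with pointwise
  operations. Over a field this is the usual tensor product: see the universal property below.
\<close>

type_synonym ('k, 'a, 'b) tensor = "('a \<Rightarrow> 'b \<Rightarrow> 'k) \<Rightarrow> 'k"

definition pure_tensor ::
  "'a \<Rightarrow> ('k::field, 'a::ab_group_add, 'm) vec_scheme \<Rightarrow> ('k, 'b::ab_group_add, 'n) vec_scheme
    \<Rightarrow> 'b \<Rightarrow> ('k, 'a, 'b) tensor" ("_ \<otimes>\<^bsub>_,_\<^esub> _" [71, 0, 0, 70] 70) where
  "a \<otimes>\<^bsub>A,B\<^esub> b = (\<lambda>\<beta>. if bilinear_map A B ground \<beta> then \<beta> a b else 0)"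

definition tensor_rep ::
  "('k::field, 'a::ab_group_add, 'm) vec_scheme \<Rightarrow> ('k, 'b::ab_group_add, 'n) vec_scheme
    \<Rightarrow> ('k, 'a, 'b) tensor \<Rightarrow> ('a \<times> 'b) list \<Rightarrow> bool" where
  "tensor_rep A B t xs \<longleftrightarrow>
     set xs \<subseteq> space A \<times> space B \<and> t = (\<Sum>(a, b)\<leftarrow>xs. a \<otimes>\<^bsub>A,B\<^esub> b)"

definition tensor ::
  "('k::field, 'a::ab_group_add, 'm) vec_scheme \<Rightarrow> ('k, 'b::ab_group_add, 'n) vec_scheme
    \<Rightarrow> ('k, ('k, 'a, 'b) tensor) vec" (infixr "\<otimes>\<^sub>V" 75) where
  "A \<otimes>\<^sub>V B = \<lparr>space = {t. \<exists>xs. tensor_rep A B t xs}, smul = (\<lambda>c t \<beta>. c * t \<beta>)\<rparr>"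

text \<open>
  Sweedler sums: if \<open>t\<close> is \<open>\<Sum> a \<otimes> b\<close>, then \<open>sweedler A B t f\<close> is \<open>\<Sum> f a b\<close>. The representation
  of \<open>t\<close> is an arbitrary one, which has no influence on the result when \<open>f\<close> is bilinear (lemma
  \<open>sweedler_eq\<close> below).
\<close>

definition sweedler ::
  "('k::field, 'a::ab_group_add, 'm) vec_scheme \<Rightarrow> ('k, 'b::ab_group_add, 'n) vec_scheme
    \<Rightarrow> ('k, 'a, 'b) tensor \<Rightarrow> ('a \<Rightarrow> 'b \<Rightarrow> 'c::ab_group_add) \<Rightarrow> 'c" where
  "sweedler A B t f = (\<Sum>(a, b)\<leftarrow>(SOME xs. tensor_rep A B t xs). f a b)"

text \<open>Iterated tensor products are bracketed to the right.\<close>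

definition pure_tensor3 ("pure\<^sub>3") where
  "pure\<^sub>3 A B C a b c = a \<otimes>\<^bsub>A,B \<otimes>\<^sub>V C\<^esub> (b \<otimes>\<^bsub>B,C\<^esub> c)"

definition pure_tensor4 ("pure\<^sub>4") where
  "pure\<^sub>4 A B C D a b c d = a \<otimes>\<^bsub>A,B \<otimes>\<^sub>V C \<otimes>\<^sub>V D\<^esub> pure\<^sub>3 B C D b c d"

subsection \<open>The universal property\<close>

lemma sum_list_fun_apply: "sum_list xs \<beta> = (\<Sum>x\<leftarrow>xs. x \<beta>)"
  for xs :: "('a \<Rightarrow> 'b::ab_group_add) list"
  by (induction xs) auto

lemma vspace_closed:
  assumes "vspace A"
  shows "0 \<in> space A"
    and "x \<in> space A \<Longrightarrow> y \<in> space A \<Longrightarrow> x + y \<in> space A"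
    and "x \<in> space A \<Longrightarrow> smul A c x \<in> space A"
proof -
  interpret vector_space "smul A"
    using assms by (simp add: vspace_def)
  show "0 \<in> space A" "x \<in> space A \<Longrightarrow> y \<in> space A \<Longrightarrow> x + y \<in> space A"
    "x \<in> space A \<Longrightarrow> smul A c x \<in> space A"
    using assms by (auto simp: vspace_def subspace_def)
qed

lemma pure_tensor_eval: "bilinear_map A B ground \<beta> \<Longrightarrow> (a \<otimes>\<^bsub>A,B\<^esub> b) \<beta> = \<beta> a b"
  by (simp add: pure_tensor_def)

lemma tensor_rep_eval:
  assumes "bilinear_map A B ground \<beta>" "tensor_rep A B t xs"
  shows "t \<beta> = (\<Sum>(a, b)\<leftarrow>xs. \<beta> a b)"
  using assms
  by (auto simp: tensor_rep_def sum_list_fun_apply pure_tensor_eval o_def case_prod_unfold)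

lemma linear_map_sum_list:
  assumes "vspace A" "vspace B" "linear_map A B f" "set xs \<subseteq> space A"
  shows "sum_list xs \<in> space A" "f (sum_list xs) = (\<Sum>x\<leftarrow>xs. f x)"
proof -
  have f0: "f 0 = 0"
    using assms(3) vspace_closed(1)[OF assms(1)] unfolding linear_map_def
    by (metis add.right_neutral add_left_cancel)
  have "sum_list xs \<in> space A \<and> f (sum_list xs) = (\<Sum>x\<leftarrow>xs. f x)"
    using assms(4)
  proof (induction xs)
    case Nil
    then show ?case using f0 vspace_closed(1)[OF assms(1)] by simp
  next
    case (Cons x xs)
    then show ?case using assms(3) vspace_closed(2)[OF assms(1)]
      by (simp add: linear_map_def)
  qed
  then show "sum_list xs \<in> space A" "f (sum_list xs) = (\<Sum>x\<leftarrow>xs. f x)" by auto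
qed

lemma vspace_ground: "vspace ground"
proof -
  interpret vector_space "(*) :: 'a::field \<Rightarrow> 'a \<Rightarrow> 'a"
    by unfold_locales (auto simp: algebra_simps)
  show ?thesis
    by (simp add: vspace_def ground_def vector_space_axioms)
qed

lemma functional_separates:
  fixes s :: "'k::field \<Rightarrow> 'v::ab_group_add \<Rightarrow> 'v"
  assumes "vector_space s" "v \<noteq> 0"
  obtains \<phi> where "\<phi> v = (1::'k)" "\<And>x y. \<phi> (x + y) = \<phi> x + \<phi> y" "\<And>c x. \<phi> (s c x) = c * \<phi> x"
proof -
  have "vector_space ((*) :: 'k \<Rightarrow> 'k \<Rightarrow> 'k)"
    using vspace_ground[where 'a = 'k] by (simp add: vspace_def ground_def)
  then interpret vector_space_pair s "(*) :: 'k \<Rightarrow> 'k \<Rightarrow> 'k"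
    using assms(1) by (simp add: vector_space_pair_def)
  have "vs1.independent {v}" using assms(2) by simp
  from linear_independent_extend[OF this, of "\<lambda>_. 1"]
  obtain g where "Vector_Spaces.linear s (*) g" "g v = 1" by auto
  with that[of g] show ?thesis
    by (simp add: Vector_Spaces.linear_iff)
qed

lemma sum_list_bilinear_eq:
  assumes V: "vspace V" and f: "bilinear_map A B V f"
    and "tensor_rep A B t xs" "tensor_rep A B t ys"
  shows "(\<Sum>(a, b)\<leftarrow>xs. f a b) = (\<Sum>(a, b)\<leftarrow>ys. f a b)"
proof (rule ccontr)
  let ?d = "(\<Sum>(a, b)\<leftarrow>xs. f a b) - (\<Sum>(a, b)\<leftarrow>ys. f a b)"
  assume "\<not> ?thesis"
  then have "?d \<noteq> 0" by simp
  moreover have "vector_space (smul V)" using V by (simp add: vspace_def)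
  ultimately obtain \<phi> where \<phi>: "\<phi> ?d = 1" "\<And>x y. \<phi> (x + y) = \<phi> x + \<phi> y"
      "\<And>c x. \<phi> (smul V c x) = c * \<phi> x"
    using functional_separates by blast
  have \<phi>0: "\<phi> 0 = 0"
    using \<phi>(2)[of 0 0] unfolding add_0_left by (metis add_cancel_left_left)
  have \<phi>sum: "\<phi> (sum_list zs) = (\<Sum>z\<leftarrow>zs. \<phi> z)" for zs
    by (induction zs) (auto simp: \<phi>(2) \<phi>0)
  have "bilinear_map A B ground (\<lambda>a b. \<phi> (f a b))"
    using f by (auto simp: bilinear_map_def linear_map_def ground_def \<phi>(2,3))
  from tensor_rep_eval[OF this assms(3)] tensor_rep_eval[OF this assms(4)]
  have "\<phi> (\<Sum>(a, b)\<leftarrow>xs. f a b) = \<phi> (\<Sum>(a, b)\<leftarrow>ys. f a b)"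
    by (simp add: \<phi>sum o_def case_prod_unfold)
  moreover have "\<phi> (\<Sum>(a, b)\<leftarrow>xs. f a b) = \<phi> ?d + \<phi> (\<Sum>(a, b)\<leftarrow>ys. f a b)"
    by (simp flip: \<phi>(2))
  ultimately show False using \<phi>(1) by simp
qed

lemma sweedler_eq:
  assumes "vspace V" "bilinear_map A B V f" "tensor_rep A B t xs"
  shows "sweedler A B t f = (\<Sum>(a, b)\<leftarrow>xs. f a b)"
  unfolding sweedler_def
  using sum_list_bilinear_eq[OF assms(1,2) someI[of "tensor_rep A B t", OF assms(3)] assms(3)] .

lemma tensor_rep_pure:
  "a \<in> space A \<Longrightarrow> b \<in> space B \<Longrightarrow> tensor_rep A B (a \<otimes>\<^bsub>A,B\<^esub> b) [(a, b)]"
  by (simp add: tensor_rep_def)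

lemma tensor_rep_append:
  "tensor_rep A B t xs \<Longrightarrow> tensor_rep A B u ys \<Longrightarrow> tensor_rep A B (t + u) (xs @ ys)"
  by (auto simp: tensor_rep_def)

lemma tensor_rep_smul:
  assumes A: "vspace A" and t: "tensor_rep A B t xs"
  shows "tensor_rep A B (smul (A \<otimes>\<^sub>V B) c t) (map (\<lambda>(a, b). (smul A c a, b)) xs)"
proof -
  have "(\<Sum>(a, b)\<leftarrow>map (\<lambda>(a, b). (smul A c a, b)) xs. a \<otimes>\<^bsub>A,B\<^esub> b) = smul (A \<otimes>\<^sub>V B) c t"
  proof
    fix \<beta>
    have "(smul A c a \<otimes>\<^bsub>A,B\<^esub> b) \<beta> = c * (a \<otimes>\<^bsub>A,B\<^esub> b) \<beta>" if "(a, b) \<in> set xs" for a b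
      using that t
      by (auto simp: tensor_rep_def pure_tensor_def bilinear_map_def linear_map_def ground_def)
    then have "(\<Sum>x\<leftarrow>xs. (smul A c (fst x) \<otimes>\<^bsub>A,B\<^esub> snd x) \<beta>)
        = (\<Sum>x\<leftarrow>xs. c * (fst x \<otimes>\<^bsub>A,B\<^esub> snd x) \<beta>)"
      by (intro arg_cong[where f = sum_list] map_cong) auto
    then show "(\<Sum>(a, b)\<leftarrow>map (\<lambda>(a, b). (smul A c a, b)) xs. a \<otimes>\<^bsub>A,B\<^esub> b) \<beta>
        = smul (A \<otimes>\<^sub>V B) c t \<beta>"
      using t by (simp add: tensor_rep_def tensor_def sum_list_fun_apply o_def case_prod_unfold
          sum_list_const_mult)
  qed
  moreover have "set (map (\<lambda>(a, b). (smul A c a, b)) xs) \<subseteq> space A \<times> space B"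
    using t vspace_closed(3)[OF A] by (auto simp: tensor_rep_def)
  ultimately show ?thesis by (simp add: tensor_rep_def)
qed

lemma space_tensor: "t \<in> space (A \<otimes>\<^sub>V B) \<longleftrightarrow> (\<exists>xs. tensor_rep A B t xs)"
  by (simp add: tensor_def)

lemma vspace_tensor:
  assumes "vspace A"
  shows "vspace (A \<otimes>\<^sub>V B)"
proof -
  interpret vector_space "smul (A \<otimes>\<^sub>V B)"
    by unfold_locales (auto simp: tensor_def fun_eq_iff algebra_simps)
  have "tensor_rep A B 0 []" by (simp add: tensor_rep_def)
  then have "subspace (space (A \<otimes>\<^sub>V B))"
    unfolding subspace_def Ball_def space_tensor
    by (auto intro: tensor_rep_append tensor_rep_smul[OF assms])
  then show ?thesis by (simp add: vspace_def vector_space_axioms)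
qed

lemma bilinear_pure_tensor: "bilinear_map A B (A \<otimes>\<^sub>V B) (\<lambda>a b. a \<otimes>\<^bsub>A,B\<^esub> b)"
  if "vspace A" "vspace B"
proof -
  have "a \<otimes>\<^bsub>A,B\<^esub> b \<in> space (A \<otimes>\<^sub>V B)" if "a \<in> space A" "b \<in> space B" for a b
    using tensor_rep_pure[OF that] space_tensor by blast
  moreover have "(a + a') \<otimes>\<^bsub>A,B\<^esub> b = a \<otimes>\<^bsub>A,B\<^esub> b + a' \<otimes>\<^bsub>A,B\<^esub> b"
    "smul A c a \<otimes>\<^bsub>A,B\<^esub> b = smul (A \<otimes>\<^sub>V B) c (a \<otimes>\<^bsub>A,B\<^esub> b)"
    if "a \<in> space A" "a' \<in> space A" "b \<in> space B" for a a' b c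
    using that
    by (auto simp: bilinear_map_def linear_map_def pure_tensor_def ground_def fun_eq_iff tensor_def)
  moreover have "a \<otimes>\<^bsub>A,B\<^esub> (b + b') = a \<otimes>\<^bsub>A,B\<^esub> b + a \<otimes>\<^bsub>A,B\<^esub> b'"
    "a \<otimes>\<^bsub>A,B\<^esub> smul B c b = smul (A \<otimes>\<^sub>V B) c (a \<otimes>\<^bsub>A,B\<^esub> b)"
    if "a \<in> space A" "b \<in> space B" "b' \<in> space B" for a b b' c
    using that
    by (auto simp: bilinear_map_def linear_map_def pure_tensor_def ground_def fun_eq_iff tensor_def)
  ultimately show ?thesis
    unfolding bilinear_map_def linear_map_def by simp
qed

theorem tensor_universal:
  assumes "vspace A" "vspace B" "vspace V" "bilinear_map A B V f"
  shows "linear_map (A \<otimes>\<^sub>V B) V (\<lambda>t. sweedler A B t f)"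
    and "\<And>a b. a \<in> space A \<Longrightarrow> b \<in> space B \<Longrightarrow> sweedler A B (a \<otimes>\<^bsub>A,B\<^esub> b) f = f a b"
    and "\<And>g t. linear_map (A \<otimes>\<^sub>V B) V g \<Longrightarrow>
      (\<And>a b. a \<in> space A \<Longrightarrow> b \<in> space B \<Longrightarrow> g (a \<otimes>\<^bsub>A,B\<^esub> b) = f a b) \<Longrightarrow>
      t \<in> space (A \<otimes>\<^sub>V B) \<Longrightarrow> g t = sweedler A B t f"
proof -
  note eq = sweedler_eq[OF assms(3,4)]
  interpret V: vector_space "smul V" using assms(3) by (simp add: vspace_def)
  have inV: "(\<Sum>(a, b)\<leftarrow>xs. f a b) \<in> space V" if "set xs \<subseteq> space A \<times> space B" for xs
    using that
  proof (induction xs)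
    case Nil
    then show ?case using vspace_closed(1)[OF assms(3)] by simp
  next
    case (Cons x xs)
    then show ?case using assms(4) vspace_closed(2)[OF assms(3)]
      by (auto simp: bilinear_map_def linear_map_def)
  qed
  have scale: "(\<Sum>(a, b)\<leftarrow>map (\<lambda>(a, b). (smul A c a, b)) xs. f a b)
      = smul V c (\<Sum>(a, b)\<leftarrow>xs. f a b)"
    if "set xs \<subseteq> space A \<times> space B" for c xs
    using that
    by (induction xs)
      (use assms(4) in \<open>auto simp: V.scale_right_distrib bilinear_map_def linear_map_def\<close>)
  show "linear_map (A \<otimes>\<^sub>V B) V (\<lambda>t. sweedler A B t f)"
    unfolding linear_map_def
  proof (intro conjI ballI allI)
    fix t u c
    assume "t \<in> space (A \<otimes>\<^sub>V B)"
    then obtain xs where xs: "tensor_rep A B t xs" by (auto simp: space_tensor)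
    then have sub: "set xs \<subseteq> space A \<times> space B" by (simp add: tensor_rep_def)
    show "sweedler A B t f \<in> space V"
      unfolding eq[OF xs] using inV[OF sub] .
    show "sweedler A B (smul (A \<otimes>\<^sub>V B) c t) f = smul V c (sweedler A B t f)"
      unfolding eq[OF xs] eq[OF tensor_rep_smul[OF assms(1) xs]] using scale[OF sub] .
    assume "u \<in> space (A \<otimes>\<^sub>V B)"
    then obtain ys where ys: "tensor_rep A B u ys" by (auto simp: space_tensor)
    show "sweedler A B (t + u) f = sweedler A B t f + sweedler A B u f"
      unfolding eq[OF xs] eq[OF ys] eq[OF tensor_rep_append[OF xs ys]] by simp
  qed
  show "sweedler A B (a \<otimes>\<^bsub>A,B\<^esub> b) f = f a b" if "a \<in> space A" "b \<in> space B" for a b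
    using eq[OF tensor_rep_pure[OF that]] by simp
  fix g t
  assume g: "linear_map (A \<otimes>\<^sub>V B) V g" "t \<in> space (A \<otimes>\<^sub>V B)"
    and gf: "\<And>a b. a \<in> space A \<Longrightarrow> b \<in> space B \<Longrightarrow> g (a \<otimes>\<^bsub>A,B\<^esub> b) = f a b"
  from g(2) obtain xs where xs: "tensor_rep A B t xs" by (auto simp: space_tensor)
  have "set (map (\<lambda>(a, b). a \<otimes>\<^bsub>A,B\<^esub> b) xs) \<subseteq> space (A \<otimes>\<^sub>V B)"
    using xs bilinear_pure_tensor[OF assms(1,2)]
    by (auto simp: tensor_rep_def bilinear_map_def linear_map_def)
  from linear_map_sum_list(2)[OF vspace_tensor[OF assms(1)] assms(3) g(1) this]
  have "g t = (\<Sum>(a, b)\<leftarrow>xs. g (a \<otimes>\<^bsub>A,B\<^esub> b))"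
    using xs by (simp add: tensor_rep_def o_def case_prod_unfold)
  also have "\<dots> = (\<Sum>(a, b)\<leftarrow>xs. f a b)"
    using xs by (intro arg_cong[where f = sum_list] map_cong) (auto simp: tensor_rep_def gf)
  finally show "g t = sweedler A B t f" using eq[OF xs] by simp
qed


section \<open>Algebras, coalgebras and bialgebras\<close>

record ('k, 'v) bialg_data = "('k, 'v) vec" +
  mul :: "'v \<Rightarrow> 'v \<Rightarrow> 'v" ("(_ \<cdot>\<index> _)" [70, 71] 70)
  unity :: 'v ("\<one>\<index>")
  comul :: "'v \<Rightarrow> ('k, 'v, 'v) tensor" ("\<Delta>\<index>")
  counit :: "'v \<Rightarrow> 'k" ("\<epsilon>\<index>")

definition algebra :: "('k::field, 'v::ab_group_add) bialg_data \<Rightarrow> bool" where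
  "algebra A \<longleftrightarrow>
     vspace A \<and>
     bilinear_map A A A (mul A) \<and>
     (\<forall>x\<in>space A. \<forall>y\<in>space A. \<forall>z\<in>space A. (x \<cdot>\<^bsub>A\<^esub> y) \<cdot>\<^bsub>A\<^esub> z = x \<cdot>\<^bsub>A\<^esub> (y \<cdot>\<^bsub>A\<^esub> z)) \<and>
     \<one>\<^bsub>A\<^esub> \<in> space A \<and>
     (\<forall>x\<in>space A. \<one>\<^bsub>A\<^esub> \<cdot>\<^bsub>A\<^esub> x = x \<and> x \<cdot>\<^bsub>A\<^esub> \<one>\<^bsub>A\<^esub> = x)"

definition coalgebra :: "('k::field, 'v::ab_group_add) bialg_data \<Rightarrow> bool" where
  "coalgebra C \<longleftrightarrow>
     vspace C \<and>
     linear_map C (C \<otimes>\<^sub>V C) \<Delta>\<^bsub>C\<^esub> \<and>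
     linear_map C ground \<epsilon>\<^bsub>C\<^esub> \<and>
     (\<forall>c\<in>space C.
        sweedler C C (\<Delta>\<^bsub>C\<^esub> c) (\<lambda>c1 c2. sweedler C C (\<Delta>\<^bsub>C\<^esub> c1) (\<lambda>c11 c12. pure\<^sub>3 C C C c11 c12 c2)) =
        sweedler C C (\<Delta>\<^bsub>C\<^esub> c) (\<lambda>c1 c2. sweedler C C (\<Delta>\<^bsub>C\<^esub> c2) (\<lambda>c21 c22. pure\<^sub>3 C C C c1 c21 c22))) \<and>
     (\<forall>c\<in>space C.
        sweedler C C (\<Delta>\<^bsub>C\<^esub> c) (\<lambda>c1 c2. smul C (\<epsilon>\<^bsub>C\<^esub> c1) c2) = c \<and>
        sweedler C C (\<Delta>\<^bsub>C\<^esub> c) (\<lambda>c1 c2. smul C (\<epsilon>\<^bsub>C\<^esub> c2) c1) = c)"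

text \<open>The multiplication of the tensor product algebra, \<open>(a \<otimes> b)(a' \<otimes> b') = aa' \<otimes> bb'\<close>.\<close>

definition tensor_mul ::
  "('k::field, 'a::ab_group_add) bialg_data \<Rightarrow> ('k, 'b::ab_group_add) bialg_data
    \<Rightarrow> ('k, 'a, 'b) tensor \<Rightarrow> ('k, 'a, 'b) tensor \<Rightarrow> ('k, 'a, 'b) tensor" where
  "tensor_mul A B s t =
     sweedler A B s (\<lambda>a b. sweedler A B t (\<lambda>a' b'. (a \<cdot>\<^bsub>A\<^esub> a') \<otimes>\<^bsub>A,B\<^esub> (b \<cdot>\<^bsub>B\<^esub> b')))"

definition bialgebra :: "('k::field, 'v::ab_group_add) bialg_data \<Rightarrow> bool" where
  "bialgebra A \<longleftrightarrow>
     algebra A \<and> coalgebra A \<and>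
     (\<forall>x\<in>space A. \<forall>y\<in>space A. \<Delta>\<^bsub>A\<^esub> (x \<cdot>\<^bsub>A\<^esub> y) = tensor_mul A A (\<Delta>\<^bsub>A\<^esub> x) (\<Delta>\<^bsub>A\<^esub> y)) \<and>
     \<Delta>\<^bsub>A\<^esub> \<one>\<^bsub>A\<^esub> = \<one>\<^bsub>A\<^esub> \<otimes>\<^bsub>A,A\<^esub> \<one>\<^bsub>A\<^esub> \<and>
     (\<forall>x\<in>space A. \<forall>y\<in>space A. \<epsilon>\<^bsub>A\<^esub> (x \<cdot>\<^bsub>A\<^esub> y) = \<epsilon>\<^bsub>A\<^esub> x * \<epsilon>\<^bsub>A\<^esub> y) \<and>
     \<epsilon>\<^bsub>A\<^esub> \<one>\<^bsub>A\<^esub> = 1"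


section \<open>Smash biproducts\<close>

text \<open>
  Identities between linear maps on a tensor product, such as multiplicativity of \<open>R\<close>, are stated
  on pure tensors.
\<close>

definition normal ::
  "('k::field, 'h::ab_group_add) bialg_data \<Rightarrow> ('k, 'l::ab_group_add) bialg_data
    \<Rightarrow> (('k, 'h, 'l) tensor \<Rightarrow> ('k, 'l, 'h) tensor) \<Rightarrow> bool" where
  "normal H L R \<longleftrightarrow>
     (\<forall>h\<in>space H. R (h \<otimes>\<^bsub>H,L\<^esub> \<one>\<^bsub>L\<^esub>) = \<one>\<^bsub>L\<^esub> \<otimes>\<^bsub>L,H\<^esub> h) \<and>
     (\<forall>l\<in>space L. R (\<one>\<^bsub>H\<^esub> \<otimes>\<^bsub>H,L\<^esub> l) = l \<otimes>\<^bsub>L,H\<^esub> \<one>\<^bsub>H\<^esub>)"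

definition multiplicative ::
  "('k::field, 'h::ab_group_add) bialg_data \<Rightarrow> ('k, 'l::ab_group_add) bialg_data
    \<Rightarrow> (('k, 'h, 'l) tensor \<Rightarrow> ('k, 'l, 'h) tensor) \<Rightarrow> bool" where
  "multiplicative H L R \<longleftrightarrow>
     (\<forall>h\<in>space H. \<forall>h'\<in>space H. \<forall>l\<in>space L.
        R ((h \<cdot>\<^bsub>H\<^esub> h') \<otimes>\<^bsub>H,L\<^esub> l) =
        sweedler L H (R (h' \<otimes>\<^bsub>H,L\<^esub> l)) (\<lambda>Rl Rh'.
        sweedler L H (R (h \<otimes>\<^bsub>H,L\<^esub> Rl)) (\<lambda>rRl rh.
          rRl \<otimes>\<^bsub>L,H\<^esub> (rh \<cdot>\<^bsub>H\<^esub> Rh')))) \<and>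
     (\<forall>h\<in>space H. \<forall>l\<in>space L. \<forall>l'\<in>space L.
        R (h \<otimes>\<^bsub>H,L\<^esub> (l \<cdot>\<^bsub>L\<^esub> l')) =
        sweedler L H (R (h \<otimes>\<^bsub>H,L\<^esub> l)) (\<lambda>Rl Rh.
        sweedler L H (R (Rh \<otimes>\<^bsub>H,L\<^esub> l')) (\<lambda>rl' rRh.
          (Rl \<cdot>\<^bsub>L\<^esub> rl') \<otimes>\<^bsub>L,H\<^esub> rRh)))"

definition conormal ::
  "('k::field, 'h::ab_group_add) bialg_data \<Rightarrow> ('k, 'l::ab_group_add) bialg_data
    \<Rightarrow> (('k, 'l, 'h) tensor \<Rightarrow> ('k, 'h, 'l) tensor) \<Rightarrow> bool" where
  "conormal H L W \<longleftrightarrow>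
     (\<forall>l\<in>space L. \<forall>h\<in>space H.
        sweedler H L (W (l \<otimes>\<^bsub>L,H\<^esub> h)) (\<lambda>Wh Wl. smul H (\<epsilon>\<^bsub>L\<^esub> Wl) Wh) = smul H (\<epsilon>\<^bsub>L\<^esub> l) h \<and>
        sweedler H L (W (l \<otimes>\<^bsub>L,H\<^esub> h)) (\<lambda>Wh Wl. smul L (\<epsilon>\<^bsub>H\<^esub> Wh) Wl) = smul L (\<epsilon>\<^bsub>H\<^esub> h) l)"

definition comultiplicative ::
  "('k::field, 'h::ab_group_add) bialg_data \<Rightarrow> ('k, 'l::ab_group_add) bialg_data
    \<Rightarrow> (('k, 'l, 'h) tensor \<Rightarrow> ('k, 'h, 'l) tensor) \<Rightarrow> bool" where
  "comultiplicative H L W \<longleftrightarrow>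
     (\<forall>l\<in>space L. \<forall>h\<in>space H.
        sweedler H L (W (l \<otimes>\<^bsub>L,H\<^esub> h)) (\<lambda>Wh Wl.
        sweedler H H (\<Delta>\<^bsub>H\<^esub> Wh) (\<lambda>Wh1 Wh2.
          pure\<^sub>3 H H L Wh1 Wh2 Wl)) =
        sweedler H H (\<Delta>\<^bsub>H\<^esub> h) (\<lambda>h1 h2.
        sweedler H L (W (l \<otimes>\<^bsub>L,H\<^esub> h1)) (\<lambda>Wh1 Wl.
        sweedler H L (W (Wl \<otimes>\<^bsub>L,H\<^esub> h2)) (\<lambda>Uh2 UWl.
          pure\<^sub>3 H H L Wh1 Uh2 UWl)))) \<and>
     (\<forall>l\<in>space L. \<forall>h\<in>space H.
        sweedler H L (W (l \<otimes>\<^bsub>L,H\<^esub> h)) (\<lambda>Wh Wl.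
        sweedler L L (\<Delta>\<^bsub>L\<^esub> Wl) (\<lambda>Wl1 Wl2.
          pure\<^sub>3 H L L Wh Wl1 Wl2)) =
        sweedler L L (\<Delta>\<^bsub>L\<^esub> l) (\<lambda>l1 l2.
        sweedler H L (W (l2 \<otimes>\<^bsub>L,H\<^esub> h)) (\<lambda>Wh Wl2.
        sweedler H L (W (l1 \<otimes>\<^bsub>L,H\<^esub> Wh)) (\<lambda>UWh Ul1.
          pure\<^sub>3 H L L UWh Ul1 Wl2))))"

definition smash_product ::
  "('k::field, 'l::ab_group_add) bialg_data \<Rightarrow> ('k, 'h::ab_group_add) bialg_data
    \<Rightarrow> (('k, 'l, 'h) tensor \<Rightarrow> ('k, 'h, 'l) tensor) \<Rightarrow> (('k, 'h, 'l) tensor \<Rightarrow> ('k, 'l, 'h) tensor)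
    \<Rightarrow> ('k, ('k, 'l, 'h) tensor) bialg_data" where
  "smash_product L H W R =
     \<lparr>space = space (L \<otimes>\<^sub>V H),
      smul = smul (L \<otimes>\<^sub>V H),
      mul = (\<lambda>s t.
        sweedler L H s (\<lambda>l h.
        sweedler L H t (\<lambda>l' h'.
        sweedler L H (R (h \<otimes>\<^bsub>H,L\<^esub> l')) (\<lambda>Rl' Rh.
          (l \<cdot>\<^bsub>L\<^esub> Rl') \<otimes>\<^bsub>L,H\<^esub> (Rh \<cdot>\<^bsub>H\<^esub> h'))))),
      unity = \<one>\<^bsub>L\<^esub> \<otimes>\<^bsub>L,H\<^esub> \<one>\<^bsub>H\<^esub>,
      comul = (\<lambda>t.
        sweedler L H t (\<lambda>l h.
        sweedler L L (\<Delta>\<^bsub>L\<^esub> l) (\<lambda>l1 l2.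
        sweedler H H (\<Delta>\<^bsub>H\<^esub> h) (\<lambda>h1 h2.
        sweedler H L (W (l2 \<otimes>\<^bsub>L,H\<^esub> h1)) (\<lambda>Wh1 Wl2.
          (l1 \<otimes>\<^bsub>L,H\<^esub> Wh1) \<otimes>\<^bsub>L \<otimes>\<^sub>V H,L \<otimes>\<^sub>V H\<^esub> (Wl2 \<otimes>\<^bsub>L,H\<^esub> h2)))))),
      counit = (\<lambda>t. sweedler L H t (\<lambda>l h. \<epsilon>\<^bsub>L\<^esub> l * \<epsilon>\<^bsub>H\<^esub> h))\<rparr>"

definition smash_biproduct ::
  "('k::field, 'l::ab_group_add) bialg_data \<Rightarrow> ('k, 'h::ab_group_add) bialg_data
    \<Rightarrow> (('k, 'l, 'h) tensor \<Rightarrow> ('k, 'h, 'l) tensor) \<Rightarrow> (('k, 'h, 'l) tensor \<Rightarrow> ('k, 'l, 'h) tensor)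
    \<Rightarrow> bool" where
  "smash_biproduct L H W R \<longleftrightarrow> bialgebra (smash_product L H W R)"

end

theory Submission
  imports Defs
begin

text \<open>
  Write \<open>i l = l \<otimes> 1\<close> and \<open>j h = 1 \<otimes> h\<close>. The unit laws and associativity on \<open>L \<otimes> H\<close>, tested on products
  of such elements, are normality and multiplicativity of \<open>R\<close>; dually, the counit laws and
  coassociativity become conormality and comultiplicativity of \<open>W\<close> once counits are applied to
  some of the tensor factors. Since \<open>l \<otimes> h = i l \<cdot> j h\<close> and the tensor square of an associative algebra is
  associative, \<open>\<Delta>\<close> is multiplicative iff it is so on the four kinds of products \<open>i l \<cdot> j h\<close>,
  \<open>i l \<cdot> i l'\<close>, \<open>j h \<cdot> j h'\<close> and \<open>j h \<cdot> i l\<close>. With normality, these are (DP5), (DP6), (DP7) and (DP8),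
  with units inserted in, or counits applied to, the tensor factors which do not occur there.
\<close>

section \<open>Sweedler sums as linear maps\<close>

text \<open>The two halves are formally dual, but \<open>L\<close> and \<open>H\<close> may be
  infinite-dimensional, so the statements on \<open>W\<close> are not obtained by dualising those on
  \<open>R\<close>. Two extraction formulas take the place of duality. The product of
  \<open>1 \<otimes> h\<close> and \<open>l \<otimes> 1\<close> is \<open>R (h \<otimes> l)\<close>,
  so a choice of elements turns equations between products into equations for \<open>R\<close>. The
  counits of \<open>L\<close> and \<open>H\<close> on the outer factors of the comultiplication of
  \<open>l \<otimes> h\<close> leave \<open>W (l \<otimes> h)\<close>, so equations for
  \<open>W\<close> come from applying a linear map to both sides of a tensor identity. The number of
  factors in (DP5) to (DP8) has its origin in the shape of the comultiplication on generators: that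
  of \<open>l \<otimes> 1\<close> ends in a unit, that of \<open>1 \<otimes> h\<close> begins with
  one. The technical obstacle is Sweedler notation: a structure map may pass through a sum, and a
  sum may be evaluated at a pure tensor, only where linearity is known. Linearity is therefore
  derived from the syntax of the term, and identities are compared as nested sums up to the order of
  independent sums.\<close>

text \<open>
  The argument \<open>V\<close>, the space of the values of \<open>f\<close>, has no influence on the value. It is there because
  rules about sums need \<open>f\<close> to be bilinear into a space that the simplifier can read off the term. The
  value 0 outside of \<open>A \<otimes> B\<close> makes the congruence rule \<open>sw_cong\<close> unconditional, so that membership of
  the bound variables is available under nested sums.
\<close>

definition sw where
  "sw A B V t f = (if t \<in> space (A \<otimes>\<^sub>V B) then sweedler A B t f else 0)"
  for V :: "('k::field, 'c::ab_group_add, 'q) vec_scheme" and f :: "'a::ab_group_add \<Rightarrow> 'b::ab_group_add \<Rightarrow> 'c"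

lemma sw_cong [cong]:
  "t = u \<Longrightarrow> (\<And>a b. a \<in> space A \<Longrightarrow> b \<in> space B \<Longrightarrow> f a b = g a b) \<Longrightarrow>
    sw A B V t f = sw A B V u g"
proof -
  assume [simp]: "t = u" and *: "\<And>a b. a \<in> space A \<Longrightarrow> b \<in> space B \<Longrightarrow> f a b = g a b"
  show ?thesis
  proof (cases "u \<in> space (A \<otimes>\<^sub>V B)")
    case True
    then have "tensor_rep A B u (SOME xs. tensor_rep A B u xs)"
      by (metis space_tensor someI_ex)
    then have "set (SOME xs. tensor_rep A B u xs) \<subseteq> space A \<times> space B"
      by (simp add: tensor_rep_def)
    then show ?thesis using *
      unfolding sw_def sweedler_def
      by (auto intro!: arg_cong[where f = sum_list] map_cong)
  qed (simp add: sw_def)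
qed

lemma bilinear_mapI:
  assumes "\<And>a. a \<in> space A \<Longrightarrow> linear_map B V (f a)"
    and "\<And>b. b \<in> space B \<Longrightarrow> linear_map A V (\<lambda>a. f a b)"
  shows "bilinear_map A B V f"
  using assms by (simp add: bilinear_map_def)

lemma linear_mapD:
  assumes "linear_map A B f"
  shows "x \<in> space A \<Longrightarrow> f x \<in> space B"
    and "x \<in> space A \<Longrightarrow> y \<in> space A \<Longrightarrow> f (x + y) = f x + f y"
    and "x \<in> space A \<Longrightarrow> f (smul A c x) = smul B c (f x)"
  using assms by (auto simp: linear_map_def)

lemma bilinear_mapD:
  assumes "bilinear_map A B V f"
  shows "a \<in> space A \<Longrightarrow> linear_map B V (f a)"
    and "b \<in> space B \<Longrightarrow> linear_map A V (\<lambda>a. f a b)"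
    and "a \<in> space A \<Longrightarrow> b \<in> space B \<Longrightarrow> f a b \<in> space V"
  using assms by (auto simp: bilinear_map_def linear_map_def)

lemma linear_map_0:
  assumes "linear_map A B f" "vspace A"
  shows "f 0 = 0"
  using assms vspace_closed(1)[OF assms(2)] unfolding linear_map_def
  by (metis add.right_neutral add_left_cancel)

lemma sw_mem:
  assumes "vspace V" "\<And>a b. a \<in> space A \<Longrightarrow> b \<in> space B \<Longrightarrow> f a b \<in> space V"
  shows "sw A B V t f \<in> space V"
proof (cases "t \<in> space (A \<otimes>\<^sub>V B)")
  case True
  define xs where "xs = (SOME xs. tensor_rep A B t xs)"
  have "tensor_rep A B t xs"
    using True unfolding xs_def by (metis space_tensor someI_ex)
  then have "set xs \<subseteq> space A \<times> space B"
    by (simp add: tensor_rep_def)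
  then have "(\<Sum>(a, b)\<leftarrow>xs. f a b) \<in> space V"
    by (induction xs) (auto simp: assms vspace_closed)
  then show ?thesis using True by (simp add: sw_def sweedler_def xs_def)
qed (simp add: sw_def vspace_closed assms)

text \<open>Both sides sum over the same chosen representation of \<open>t\<close>, so the claim is
  additivity of \<open>g\<close> along one finite sum. This is why the condition on \<open>f\<close>
  is membership of its values only.\<close>

lemma linear_map_sw:
  assumes g: "linear_map V U g" and V: "vspace V"
    and f: "\<And>a b. a \<in> space A \<Longrightarrow> b \<in> space B \<Longrightarrow> f a b \<in> space V"
  shows "g (sw A B V t f) = sw A B U t (\<lambda>a b. g (f a b))"
proof (cases "t \<in> space (A \<otimes>\<^sub>V B)")
  case True
  define xs where "xs = (SOME xs. tensor_rep A B t xs)"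
  have "tensor_rep A B t xs"
    using True unfolding xs_def by (metis space_tensor someI_ex)
  then have "set xs \<subseteq> space A \<times> space B"
    by (simp add: tensor_rep_def)
  then have "(\<Sum>(a, b)\<leftarrow>xs. f a b) \<in> space V \<and> g (\<Sum>(a, b)\<leftarrow>xs. f a b) = (\<Sum>(a, b)\<leftarrow>xs. g (f a b))"
    by (induction xs) (auto simp: vspace_closed V linear_map_0[OF g V] linear_mapD[OF g] f)
  then show ?thesis using True by (simp add: sw_def sweedler_def xs_def)
qed (simp add: sw_def linear_map_0[OF g V])

lemma sw_linear:
  assumes "vspace A" "vspace B" "vspace V" "bilinear_map A B V f"
  shows "linear_map (A \<otimes>\<^sub>V B) V (\<lambda>t. sw A B V t f)"
  using tensor_universal(1)[OF assms] vspace_closed[OF vspace_tensor[OF assms(1), where B = B]]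
  by (auto simp: linear_map_def sw_def)

lemma pure_mem:
  "a \<in> space A \<Longrightarrow> b \<in> space B \<Longrightarrow> a \<otimes>\<^bsub>A,B\<^esub> b \<in> space (A \<otimes>\<^sub>V B)"
  using tensor_rep_pure space_tensor by blast

lemma sw_pure:
  assumes "vspace A" "vspace B" "vspace V" "bilinear_map A B V f" "a \<in> space A" "b \<in> space B"
  shows "sw A B V (a \<otimes>\<^bsub>A,B\<^esub> b) f = f a b"
  using tensor_universal(2)[OF assms] pure_mem[OF assms(5,6)] by (simp add: sw_def)

lemma sw_unique:
  assumes "vspace A" "vspace B" "vspace V" "linear_map (A \<otimes>\<^sub>V B) V g" "t \<in> space (A \<otimes>\<^sub>V B)"
  shows "g t = sw A B V t (\<lambda>a b. g (a \<otimes>\<^bsub>A,B\<^esub> b))"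
proof -
  have "bilinear_map A B V (\<lambda>a b. g (a \<otimes>\<^bsub>A,B\<^esub> b))"
    using bilinear_pure_tensor[OF assms(1,2)] assms(4)
    by (auto simp: bilinear_map_def linear_map_def)
  from tensor_universal(3)[OF assms(1-3) this assms(4) _ assms(5)] show ?thesis
    using assms(5) by (simp add: sw_def)
qed

lemma linear_map_id: "linear_map A A (\<lambda>x. x)"
  by (simp add: linear_map_def)

lemma sw_id:
  assumes "vspace A" "vspace B" "t \<in> space (A \<otimes>\<^sub>V B)"
  shows "sw A B (A \<otimes>\<^sub>V B) t (\<lambda>a b. a \<otimes>\<^bsub>A,B\<^esub> b) = t"
  using sw_unique[OF assms(1,2) vspace_tensor[OF assms(1)] linear_map_id assms(3)] by simp

lemma linear_map_sw1:
  assumes "vspace A" "vspace B" "vspace V" "linear_map C (A \<otimes>\<^sub>V B) t" "bilinear_map A B V f"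
  shows "linear_map C V (\<lambda>c. sw A B V (t c) f)"
  using sw_linear[OF assms(1,2,3,5)] assms(4) by (simp add: linear_map_def)

lemma sum_list_add: "(\<Sum>(a, b)\<leftarrow>xs. f a b + g a b) = (\<Sum>(a, b)\<leftarrow>xs. f a b) + (\<Sum>(a, b)\<leftarrow>xs. g a b)"
  for f :: "'a \<Rightarrow> 'b \<Rightarrow> 'c::ab_group_add"
  by (induction xs) auto

lemma sw_add:
  "sw A B V t (\<lambda>a b. f a b + g a b) = sw A B V t f + sw A B V t g"
  by (simp add: sw_def sweedler_def sum_list_add)

lemma smul_linear:
  assumes "vspace V"
  shows "linear_map V V (smul V c)"
proof -
  interpret vector_space "smul V" using assms by (simp add: vspace_def)
  show ?thesis using vspace_closed[OF assms]
    by (auto simp: linear_map_def scale_right_distrib mult.commute)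
qed

lemma smul_linear1:
  assumes "vspace V" "v \<in> space V"
  shows "linear_map ground V (\<lambda>c. smul V c v)"
proof -
  interpret vector_space "smul V" using assms by (simp add: vspace_def)
  show ?thesis using vspace_closed[OF assms(1)]  assms(2)
    by (auto simp: linear_map_def scale_left_distrib ground_def)
qed

lemma sw_smul:
  assumes "vspace V" "\<And>a b. a \<in> space A \<Longrightarrow> b \<in> space B \<Longrightarrow> f a b \<in> space V"
  shows "sw A B V t (\<lambda>a b. smul V c (f a b)) = smul V c (sw A B V t f)"
  by (rule linear_map_sw[OF smul_linear[OF assms(1)] assms, symmetric])

lemma linear_map_sw2:
  assumes V: "vspace V" and f: "\<And>a b. a \<in> space A \<Longrightarrow> b \<in> space B \<Longrightarrow> linear_map C V (\<lambda>c. f c a b)"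
  shows "linear_map C V (\<lambda>c. sw A B V t (f c))"
proof -
  note fD = linear_mapD[OF f]
  show ?thesis
    by (simp add: linear_map_def fD sw_mem V sw_add sw_smul[OF V])
qed

text \<open>Interchange of two finite sums, taken over the chosen representations of
  \<open>t\<close> and \<open>u\<close>. Independence of the sums is visible in the binding:
  \<open>u\<close> contains neither \<open>a\<close> nor \<open>b\<close>.\<close>

lemma sw_swap:
  "sw A B V t (\<lambda>a b. sw C D V u (\<lambda>c d. f a b c d)) = sw C D V u (\<lambda>c d. sw A B V t (\<lambda>a b. f a b c d))"
proof -
  have 0: "(\<Sum>(a, b)\<leftarrow>xs. 0) = (0 :: 'x::ab_group_add)" for xs :: "('y \<times> 'z) list"
    by (induction xs) auto
  have "(\<Sum>(a, b)\<leftarrow>xs. \<Sum>(c, d)\<leftarrow>ys. f a b c d) = (\<Sum>(c, d)\<leftarrow>ys. \<Sum>(a, b)\<leftarrow>xs. f a b c d)" for xs ys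
    by (induction xs) (auto simp: 0 sum_list_add)
  then show ?thesis by (simp add: sw_def sweedler_def 0)
qed

lemma sw_sw:
  assumes "vspace A" "vspace B" "vspace V" "bilinear_map A B V g"
    and "\<And>c d. c \<in> space C \<Longrightarrow> d \<in> space D \<Longrightarrow> f c d \<in> space (A \<otimes>\<^sub>V B)"
  shows "sw A B V (sw C D (A \<otimes>\<^sub>V B) t f) g = sw C D V t (\<lambda>c d. sw A B V (f c d) g)"
  using linear_map_sw[OF sw_linear[OF assms(1-4)] vspace_tensor[OF assms(1)] assms(5)] .

lemma sweedler_sw: "t \<in> space (A \<otimes>\<^sub>V B) \<Longrightarrow> sweedler A B t f = sw A B V t f"
  by (simp add: sw_def)

section \<open>Bialgebra axioms and linearity rules for Sweedler expressions\<close>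

lemma bialgebraD:
  assumes "bialgebra C"
  shows "vspace C"
    and "\<one>\<^bsub>C\<^esub> \<in> space C"
    and "x \<in> space C \<Longrightarrow> y \<in> space C \<Longrightarrow> x \<cdot>\<^bsub>C\<^esub> y \<in> space C"
    and "x \<in> space C \<Longrightarrow> \<one>\<^bsub>C\<^esub> \<cdot>\<^bsub>C\<^esub> x = x"
    and "x \<in> space C \<Longrightarrow> x \<cdot>\<^bsub>C\<^esub> \<one>\<^bsub>C\<^esub> = x"
    and "x \<in> space C \<Longrightarrow> y \<in> space C \<Longrightarrow> z \<in> space C \<Longrightarrow> (x \<cdot>\<^bsub>C\<^esub> y) \<cdot>\<^bsub>C\<^esub> z = x \<cdot>\<^bsub>C\<^esub> (y \<cdot>\<^bsub>C\<^esub> z)"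
    and "x \<in> space C \<Longrightarrow> \<Delta>\<^bsub>C\<^esub> x \<in> space (C \<otimes>\<^sub>V C)"
    and "x \<in> space C \<Longrightarrow> y \<in> space C \<Longrightarrow> \<epsilon>\<^bsub>C\<^esub> (x \<cdot>\<^bsub>C\<^esub> y) = \<epsilon>\<^bsub>C\<^esub> x * \<epsilon>\<^bsub>C\<^esub> y"
    and "\<epsilon>\<^bsub>C\<^esub> \<one>\<^bsub>C\<^esub> = 1"
    and "\<Delta>\<^bsub>C\<^esub> \<one>\<^bsub>C\<^esub> = \<one>\<^bsub>C\<^esub> \<otimes>\<^bsub>C,C\<^esub> \<one>\<^bsub>C\<^esub>"
    and "bilinear_map C C C (mul C)"
    and "linear_map C (C \<otimes>\<^sub>V C) \<Delta>\<^bsub>C\<^esub>"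
    and "linear_map C ground \<epsilon>\<^bsub>C\<^esub>"
  using assms
  by (auto simp: bialgebra_def algebra_def coalgebra_def bilinear_mapD(3) linear_mapD(1))

lemma bialgebra_coassoc:
  assumes "bialgebra C" "c \<in> space C"
  shows "sweedler C C (\<Delta>\<^bsub>C\<^esub> c) (\<lambda>c1 c2. sweedler C C (\<Delta>\<^bsub>C\<^esub> c1) (\<lambda>c11 c12. pure\<^sub>3 C C C c11 c12 c2)) =
        sweedler C C (\<Delta>\<^bsub>C\<^esub> c) (\<lambda>c1 c2. sweedler C C (\<Delta>\<^bsub>C\<^esub> c2) (\<lambda>c21 c22. pure\<^sub>3 C C C c1 c21 c22))"
    and "sweedler C C (\<Delta>\<^bsub>C\<^esub> c) (\<lambda>c1 c2. smul C (\<epsilon>\<^bsub>C\<^esub> c1) c2) = c"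
    and "sweedler C C (\<Delta>\<^bsub>C\<^esub> c) (\<lambda>c1 c2. smul C (\<epsilon>\<^bsub>C\<^esub> c2) c1) = c"
  using assms by (auto simp: bialgebra_def coalgebra_def)

lemma bialgebra_comul_mul:
  "bialgebra C \<Longrightarrow> x \<in> space C \<Longrightarrow> y \<in> space C \<Longrightarrow> \<Delta>\<^bsub>C\<^esub> (x \<cdot>\<^bsub>C\<^esub> y) = tensor_mul C C (\<Delta>\<^bsub>C\<^esub> x) (\<Delta>\<^bsub>C\<^esub> y)"
  by (auto simp: bialgebra_def)

lemma space_ground: "space ground = UNIV" and smul_ground: "smul ground c x = c * x"
  by (simp_all add: ground_def)

lemma linear_map_comp:
  "linear_map B V g \<Longrightarrow> linear_map A B f \<Longrightarrow> linear_map A V (\<lambda>x. g (f x))"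
  by (simp add: linear_map_def)

lemmas linear_map_mul1 = linear_map_comp[OF bilinear_mapD(1)[OF bialgebraD(11)]]
lemmas linear_map_mul2 = linear_map_comp[OF bilinear_mapD(2)[OF bialgebraD(11)]]
lemmas linear_map_pure1 = linear_map_comp[OF bilinear_mapD(1)[OF bilinear_pure_tensor]]
lemmas linear_map_pure2 = linear_map_comp[OF bilinear_mapD(2)[OF bilinear_pure_tensor]]
lemmas linear_map_comul = linear_map_comp[OF bialgebraD(12)]
lemmas linear_map_counit = linear_map_comp[OF bialgebraD(13)]
lemmas linear_map_smul1 = linear_map_comp[OF smul_linear]
lemmas linear_map_smul2 = linear_map_comp[OF smul_linear1]

lemma linear_map_times:
  "linear_map A ground f \<Longrightarrow> linear_map A ground (\<lambda>x. c * f x)"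
  "linear_map A ground f \<Longrightarrow> linear_map A ground (\<lambda>x. f x * c)"
  by (auto simp: linear_map_def ground_def algebra_simps)

lemma smul_mem: "vspace V \<Longrightarrow> x \<in> space V \<Longrightarrow> smul V c x \<in> space V"
  by (simp add: vspace_closed)

lemmas sweedler_mem = UNIV_I space_ground vspace_ground vspace_tensor bialgebraD(1,2,3,7) pure_mem sw_mem smul_mem

text \<open>In a Sweedler expression each variable occurs once. At a sum it is thus either in the
  tensor (\<open>linear_map_sw1\<close>) or in the summand (\<open>linear_map_sw2\<close>), and at a
  structure map in one argument, so linearity is found by descending along the term.\<close>

lemmas sweedler_linear = bilinear_mapI linear_map_id linear_map_mul1 linear_map_mul2 linear_map_pure1 linear_map_pure2
  linear_map_comul linear_map_counit linear_map_smul1 linear_map_smul2 linear_map_times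
  linear_map_sw1 linear_map_sw2

context
  notes [simp] = sweedler_mem sweedler_linear
begin

section \<open>Moving sums and scalars out of the structure maps\<close>

lemma sw_pull_bialgebra:
  assumes "\<And>a b. a \<in> space A \<Longrightarrow> b \<in> space B \<Longrightarrow> f a b \<in> space V" and "bialgebra V"
  shows "x \<in> space V \<Longrightarrow> x \<cdot>\<^bsub>V\<^esub> sw A B V t f = sw A B V t (\<lambda>a b. x \<cdot>\<^bsub>V\<^esub> f a b)"
    and "x \<in> space V \<Longrightarrow> sw A B V t f \<cdot>\<^bsub>V\<^esub> x = sw A B V t (\<lambda>a b. f a b \<cdot>\<^bsub>V\<^esub> x)"
    and "\<Delta>\<^bsub>V\<^esub> (sw A B V t f) = sw A B (V \<otimes>\<^sub>V V) t (\<lambda>a b. \<Delta>\<^bsub>V\<^esub> (f a b))"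
    and "\<epsilon>\<^bsub>V\<^esub> (sw A B V t f) = sw A B ground t (\<lambda>a b. \<epsilon>\<^bsub>V\<^esub> (f a b))"
  by (rule linear_map_sw; simp add: assms)+

lemma sw_pull_pure:
  assumes "\<And>a b. a \<in> space A \<Longrightarrow> b \<in> space B \<Longrightarrow> f a b \<in> space V" and "vspace V" and "vspace U" "u \<in> space U"
  shows "u \<otimes>\<^bsub>U,V\<^esub> sw A B V t f = sw A B (U \<otimes>\<^sub>V V) t (\<lambda>a b. u \<otimes>\<^bsub>U,V\<^esub> f a b)"
    and "sw A B V t f \<otimes>\<^bsub>V,U\<^esub> u = sw A B (V \<otimes>\<^sub>V U) t (\<lambda>a b. f a b \<otimes>\<^bsub>V,U\<^esub> u)"
  by (rule linear_map_sw; simp add: assms)+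

lemma sw_pull_ground:
  "vspace V \<Longrightarrow> v \<in> space V \<Longrightarrow> smul V (sw A B ground t g) v = sw A B V t (\<lambda>a b. smul V (g a b) v)"
  "c * sw A B ground t g = sw A B ground t (\<lambda>a b. c * g a b)"
  "sw A B ground t g * c = sw A B ground t (\<lambda>a b. g a b * c)"
  by (rule linear_map_sw; simp)+

lemma smul_pull_bialgebra:
  assumes "bialgebra V" and v: "v \<in> space V"
  shows "x \<in> space V \<Longrightarrow> x \<cdot>\<^bsub>V\<^esub> smul V c v = smul V c (x \<cdot>\<^bsub>V\<^esub> v)"
    and "x \<in> space V \<Longrightarrow> smul V c v \<cdot>\<^bsub>V\<^esub> x = smul V c (v \<cdot>\<^bsub>V\<^esub> x)"
    and "\<Delta>\<^bsub>V\<^esub> (smul V c v) = smul (V \<otimes>\<^sub>V V) c (\<Delta>\<^bsub>V\<^esub> v)"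
    and "\<epsilon>\<^bsub>V\<^esub> (smul V c v) = c * \<epsilon>\<^bsub>V\<^esub> v"
  by (rule linear_mapD(3)[OF _ v, where B = ground, unfolded smul_ground] linear_mapD(3)[OF _ v]; simp add: assms)+

lemma smul_pull_pure:
  assumes "vspace V" and v: "v \<in> space V" and "vspace U" "u \<in> space U"
  shows "u \<otimes>\<^bsub>U,V\<^esub> smul V c v = smul (U \<otimes>\<^sub>V V) c (u \<otimes>\<^bsub>U,V\<^esub> v)"
    and "smul V c v \<otimes>\<^bsub>V,U\<^esub> u = smul (V \<otimes>\<^sub>V U) c (v \<otimes>\<^bsub>V,U\<^esub> u)"
  by (rule linear_mapD(3)[OF _ v]; simp add: assms)+

lemma smul_smul: "vspace V \<Longrightarrow> smul V c (smul V d x) = smul V (c * d) x"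
  and smul_one: "vspace V \<Longrightarrow> smul V 1 x = x"
  by (auto simp: vspace_def vector_space_def)

lemma smul_left_commute: "vspace V \<Longrightarrow> smul V c (smul V d x) = smul V d (smul V c x)"
  by (simp add: smul_smul mult.commute)

text \<open>A scalar that depends on the summation variables may stand in front of one that does
  not. Taking the latter out isolates a counit under its own sum, the shape in which the counit laws
  are stated.\<close>

lemma sw_smul_smul:
  assumes "vspace V" "\<And>a b. a \<in> space A \<Longrightarrow> b \<in> space B \<Longrightarrow> f a b \<in> space V"
  shows "sw A B V t (\<lambda>a b. smul V (g a b) (smul V c (f a b))) = smul V c (sw A B V t (\<lambda>a b. smul V (g a b) (f a b)))"
  using assms by (simp add: smul_left_commute[of V _ c] sw_smul)

lemma sw_smul_arg:
  assumes "vspace A" "vspace B" "vspace V" "bilinear_map A B V f" "t \<in> space (A \<otimes>\<^sub>V B)"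
  shows "sw A B V (smul (A \<otimes>\<^sub>V B) c t) f = smul V c (sw A B V t f)"
  by (rule linear_mapD(3)[OF _ assms(5)]; simp add: assms)

text \<open>The universal property of the triple tensor product, with the induced linear map written
  as a nested sum. Applied to both sides of an identity between sums of \<open>pure\<^sub>3\<close>,
  it replaces \<open>pure\<^sub>3\<close> by an arbitrary trilinear \<open>F\<close>.\<close>

lemma lift3:
  assumes "vspace A" "vspace B" "vspace C" "vspace V"
    "\<And>b c. b \<in> space B \<Longrightarrow> c \<in> space C \<Longrightarrow> linear_map A V (\<lambda>a. F a b c)"
    "\<And>a c. a \<in> space A \<Longrightarrow> c \<in> space C \<Longrightarrow> linear_map B V (\<lambda>b. F a b c)"
    "\<And>a b. a \<in> space A \<Longrightarrow> b \<in> space B \<Longrightarrow> linear_map C V (\<lambda>c. F a b c)"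
  shows "linear_map (A \<otimes>\<^sub>V B \<otimes>\<^sub>V C) V (\<lambda>t. sw A (B \<otimes>\<^sub>V C) V t (\<lambda>a u. sw B C V u (F a)))"
    and "a \<in> space A \<Longrightarrow> b \<in> space B \<Longrightarrow> c \<in> space C \<Longrightarrow>
      sw A (B \<otimes>\<^sub>V C) V (pure\<^sub>3 A B C a b c) (\<lambda>a u. sw B C V u (F a)) = F a b c"
  by (simp_all add: assms pure_tensor3_def sw_pure)

lemma pure3_mem: "a \<in> space A \<Longrightarrow> b \<in> space B \<Longrightarrow> c \<in> space C \<Longrightarrow> pure\<^sub>3 A B C a b c \<in> space (A \<otimes>\<^sub>V B \<otimes>\<^sub>V C)"
  by (simp add: pure_tensor3_def)

text \<open>The image of coassociativity under the linear map of \<open>lift3\<close>. From left to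
  right, it turns every iterated comultiplication into one that splits the second factor.\<close>

lemma coassoc:
  assumes C: "bialgebra C" and c: "c \<in> space C" and V: "vspace V"
    and F: "\<And>b c. b \<in> space C \<Longrightarrow> c \<in> space C \<Longrightarrow> linear_map C V (\<lambda>a. F a b c)"
    "\<And>a c. a \<in> space C \<Longrightarrow> c \<in> space C \<Longrightarrow> linear_map C V (\<lambda>b. F a b c)"
    "\<And>a b. a \<in> space C \<Longrightarrow> b \<in> space C \<Longrightarrow> linear_map C V (\<lambda>c. F a b c)"
  shows "sw C C V (\<Delta>\<^bsub>C\<^esub> c) (\<lambda>a b. sw C C V (\<Delta>\<^bsub>C\<^esub> a) (\<lambda>a1 a2. F a1 a2 b)) =
    sw C C V (\<Delta>\<^bsub>C\<^esub> c) (\<lambda>a b. sw C C V (\<Delta>\<^bsub>C\<^esub> b) (\<lambda>b1 b2. F a b1 b2))"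
proof -
  let ?T = "C \<otimes>\<^sub>V C \<otimes>\<^sub>V C"
  have [simp]: "bialgebra C" "c \<in> space C" "vspace C" "vspace V" using C c V bialgebraD(1) by auto
  have "sw C C ?T (\<Delta>\<^bsub>C\<^esub> c) (\<lambda>a b. sw C C ?T (\<Delta>\<^bsub>C\<^esub> a) (\<lambda>a1 a2. pure\<^sub>3 C C C a1 a2 b)) =
    sw C C ?T (\<Delta>\<^bsub>C\<^esub> c) (\<lambda>a b. sw C C ?T (\<Delta>\<^bsub>C\<^esub> b) (\<lambda>b1 b2. pure\<^sub>3 C C C a b1 b2))"
    using bialgebra_coassoc(1)[OF C c] by (simp add: sweedler_sw[where V = "?T"])
  note * = arg_cong[OF this, of "\<lambda>t. sw C (C \<otimes>\<^sub>V C) V t (\<lambda>a u. sw C C V u (F a))"]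
  then show ?thesis
    by (simp add: F pure3_mem linear_map_sw[OF lift3(1)] lift3(2))
qed

lemma counit_left:
  assumes C: "bialgebra C" and c: "c \<in> space C" and V: "vspace V" and F: "linear_map C V F"
  shows "sw C C V (\<Delta>\<^bsub>C\<^esub> c) (\<lambda>a b. smul V (\<epsilon>\<^bsub>C\<^esub> a) (F b)) = F c"
proof -
  have [simp]: "bialgebra C" "c \<in> space C" "vspace C" "vspace V" using C c V bialgebraD(1) by auto
  have "sw C C C (\<Delta>\<^bsub>C\<^esub> c) (\<lambda>a b. smul C (\<epsilon>\<^bsub>C\<^esub> a) b) = c"
    using bialgebra_coassoc(2)[OF C c] by (simp add: sweedler_sw[where V = C])
  from arg_cong[OF this, of F] show ?thesis
    by (simp add: linear_map_sw[OF F] linear_mapD[OF F])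
qed

lemma counit_right:
  assumes C: "bialgebra C" and c: "c \<in> space C" and V: "vspace V" and F: "linear_map C V F"
  shows "sw C C V (\<Delta>\<^bsub>C\<^esub> c) (\<lambda>a b. smul V (\<epsilon>\<^bsub>C\<^esub> b) (F a)) = F c"
proof -
  have [simp]: "bialgebra C" "c \<in> space C" "vspace C" "vspace V" using C c V bialgebraD(1) by auto
  have "sw C C C (\<Delta>\<^bsub>C\<^esub> c) (\<lambda>a b. smul C (\<epsilon>\<^bsub>C\<^esub> b) a) = c"
    using bialgebra_coassoc(3)[OF C c] by (simp add: sweedler_sw[where V = C])
  from arg_cong[OF this, of F] show ?thesis
    by (simp add: linear_map_sw[OF F] linear_mapD[OF F])
qed

lemma comul_mul:
  assumes C: "bialgebra C" and "x \<in> space C" "y \<in> space C"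
  shows "\<Delta>\<^bsub>C\<^esub> (x \<cdot>\<^bsub>C\<^esub> y) =
    sw C C (C \<otimes>\<^sub>V C) (\<Delta>\<^bsub>C\<^esub> x) (\<lambda>x1 x2. sw C C (C \<otimes>\<^sub>V C) (\<Delta>\<^bsub>C\<^esub> y) (\<lambda>y1 y2.
      (x1 \<cdot>\<^bsub>C\<^esub> y1) \<otimes>\<^bsub>C,C\<^esub> (x2 \<cdot>\<^bsub>C\<^esub> y2)))"
  using bialgebra_comul_mul[OF assms] assms by (simp add: tensor_mul_def sweedler_sw[where V = "C \<otimes>\<^sub>V C"])

end

text \<open>Bubble sort: applied repeatedly as introduction rules, with \<open>refl\<close> before \<open>sw_front\<close>, these bring
  independent sums on the left into the order on the right. The function \<open>g'\<close> is found by unification.\<close>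

lemma sw_front:
  assumes "\<And>a b. f a b = sw C D V u (g' a b)"
    and "\<And>c d. c \<in> space C \<Longrightarrow> d \<in> space D \<Longrightarrow> sw A B V t (\<lambda>a b. g' a b c d) = g c d"
  shows "sw A B V t f = sw C D V u g"
proof -
  have "sw A B V t f = sw C D V u (\<lambda>c d. sw A B V t (\<lambda>a b. g' a b c d))"
    by (subst sw_swap) (rule sw_cong[OF refl assms(1)])
  also have "\<dots> = sw C D V u g"
    by (rule sw_cong[OF refl assms(2)])
  finally show ?thesis .
qed

lemmas sw_sort = refl sw_cong[OF refl] sw_front

section \<open>The smash product\<close>

lemma bilinear_map_same_vec:
  assumes "space A = space A'" "smul A = smul A'" "space B = space B'" "smul B = smul B'"
  shows "bilinear_map A B ground f = bilinear_map A' B' ground f"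
  using assms by (simp add: bilinear_map_def linear_map_def)

text \<open>The smash product is a record with more fields than
  \<open>L \<otimes>\<^sub>V H\<close>, but pure tensors see only carrier and scalars. The
  predicates \<open>tensor_rep\<close> are then equal, hence so are the representations chosen from
  them, and the bialgebra axioms can be read over \<open>L \<otimes>\<^sub>V H\<close>.\<close>

lemma same_vec:
  assumes "space A = space A'" "smul A = smul A'"
  shows "pure_tensor a A A b = pure_tensor a A' A' b"
    and "tensor_rep A A = tensor_rep A' A'"
    and "A \<otimes>\<^sub>V A = A' \<otimes>\<^sub>V A'"
    and "sweedler A A t f = sweedler A' A' t f"
proof -
  show 1: "pure_tensor a A A b = pure_tensor a A' A' b" for a b
    by (simp add: pure_tensor_def bilinear_map_same_vec[OF assms assms])
  show 2: "tensor_rep A A = tensor_rep A' A'"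
    by (simp add: fun_eq_iff tensor_rep_def 1 assms)
  show "A \<otimes>\<^sub>V A = A' \<otimes>\<^sub>V A'" "sweedler A A t f = sweedler A' A' t f"
    by (simp_all add: tensor_def sweedler_def 2)
qed

section \<open>Operations and bialgebra axioms of the smash product\<close>

locale smash_data =
  fixes H :: "('k::field, 'h::ab_group_add) bialg_data"
    and L :: "('k, 'l::ab_group_add) bialg_data"
    and R :: "('k, 'h, 'l) tensor \<Rightarrow> ('k, 'l, 'h) tensor"
    and W :: "('k, 'l, 'h) tensor \<Rightarrow> ('k, 'h, 'l) tensor"
  assumes H: "bialgebra H" and L: "bialgebra L"
    and R: "linear_map (H \<otimes>\<^sub>V L) (L \<otimes>\<^sub>V H) R"
    and W: "linear_map (L \<otimes>\<^sub>V H) (H \<otimes>\<^sub>V L) W"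
begin

lemmas vspace_HL = bialgebraD(1)[OF H] bialgebraD(1)[OF L]
lemmas R_mem = linear_mapD(1)[OF R] and W_mem = linear_mapD(1)[OF W]
lemmas R_linear = linear_map_comp[OF R] and W_linear = linear_map_comp[OF W]
lemmas R_pull = linear_map_sw[OF R vspace_tensor[OF vspace_HL(1)]] linear_map_sw[OF W vspace_tensor[OF vspace_HL(2)]]
lemmas R_smul = linear_mapD(3)[OF R] linear_mapD(3)[OF W]

lemmas [simp] = H L vspace_HL sweedler_mem sweedler_linear R_mem W_mem R_linear W_linear
text \<open>These rules aim at a normal form: nested sums over values of \<open>R\<close>,
  \<open>W\<close> and the comultiplications, scalars as far out as their variables permit, and
  inside them pure tensors of products bracketed to the right.\<close>

lemmas sweedler_calc = sw_pull_bialgebra sw_pull_pure sw_pull_ground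
  smul_pull_bialgebra smul_pull_pure R_pull R_smul sw_sw sw_pure sw_id smul_smul[symmetric] smul_one sw_smul sw_smul_smul
 sw_smul_arg smul_ground bialgebraD(4-6,8-10) comul_mul

abbreviation "LH \<equiv> L \<otimes>\<^sub>V H"
abbreviation "HL \<equiv> H \<otimes>\<^sub>V L"
abbreviation "A \<equiv> smash_product L H W R"

text \<open>The space \<open>V\<close> occurs only on the right of \<open>sweedler_sw\<close>, so it
  has to be fixed in advance. The spaces listed have pairwise different types, and type matching
  selects the instance.\<close>

lemmas sweedler_sw_types =
  sweedler_sw[where V = L] sweedler_sw[where V = H] sweedler_sw[where V = ground]
  sweedler_sw[where V = LH] sweedler_sw[where V = HL] sweedler_sw[where V = "LH \<otimes>\<^sub>V LH"]
  sweedler_sw[where V = "LH \<otimes>\<^sub>V LH \<otimes>\<^sub>V LH"]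
  sweedler_sw[where V = "L \<otimes>\<^sub>V H \<otimes>\<^sub>V L"] sweedler_sw[where V = "H \<otimes>\<^sub>V L \<otimes>\<^sub>V H"]
  sweedler_sw[where V = "H \<otimes>\<^sub>V H \<otimes>\<^sub>V L"] sweedler_sw[where V = "H \<otimes>\<^sub>V L \<otimes>\<^sub>V L"]
  sweedler_sw[where V = "L \<otimes>\<^sub>V H \<otimes>\<^sub>V L \<otimes>\<^sub>V H"]

text \<open>The operations \<open>m\<close>, \<open>d\<close> and \<open>e\<close> restate the
  fields of \<open>smash_product\<close> with \<open>sw\<close> for \<open>sweedler\<close>. They
  agree with the fields on the carrier, and the value 0 elsewhere makes membership of their results
  unconditional.\<close>

definition m where
  "m s t = sw L H LH s (\<lambda>l h. sw L H LH t (\<lambda>l' h'. sw L H LH (R (h \<otimes>\<^bsub>H,L\<^esub> l')) (\<lambda>Rl' Rh.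
     (l \<cdot>\<^bsub>L\<^esub> Rl') \<otimes>\<^bsub>L,H\<^esub> (Rh \<cdot>\<^bsub>H\<^esub> h'))))"

definition d where
  "d t = sw L H (LH \<otimes>\<^sub>V LH) t (\<lambda>l h. sw L L (LH \<otimes>\<^sub>V LH) (\<Delta>\<^bsub>L\<^esub> l) (\<lambda>l1 l2.
     sw H H (LH \<otimes>\<^sub>V LH) (\<Delta>\<^bsub>H\<^esub> h) (\<lambda>h1 h2. sw H L (LH \<otimes>\<^sub>V LH) (W (l2 \<otimes>\<^bsub>L,H\<^esub> h1)) (\<lambda>Wh1 Wl2.
          (l1 \<otimes>\<^bsub>L,H\<^esub> Wh1) \<otimes>\<^bsub>LH,LH\<^esub> (Wl2 \<otimes>\<^bsub>L,H\<^esub> h2)))))"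

definition e where
  "e t = sw L H ground t (\<lambda>l h. \<epsilon>\<^bsub>L\<^esub> l * \<epsilon>\<^bsub>H\<^esub> h)"

lemma smash_same_vec: "space A = space LH" "smul A = smul LH"
  by (simp_all add: smash_product_def)

lemma smash_unity: "\<one>\<^bsub>A\<^esub> = \<one>\<^bsub>L\<^esub> \<otimes>\<^bsub>L,H\<^esub> \<one>\<^bsub>H\<^esub>"
  by (simp_all add: smash_product_def)

lemma smash_mul: "s \<in> space LH \<Longrightarrow> t \<in> space LH \<Longrightarrow> s \<cdot>\<^bsub>A\<^esub> t = m s t"
  by (simp add: smash_product_def m_def sweedler_sw_types)

lemma smash_comul: "t \<in> space LH \<Longrightarrow> \<Delta>\<^bsub>A\<^esub> t = d t"
  by (simp add: smash_product_def d_def sweedler_sw_types)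

lemma smash_counit: "t \<in> space LH \<Longrightarrow> \<epsilon>\<^bsub>A\<^esub> t = e t"
  by (simp add: smash_product_def e_def sweedler_sw_types)

lemma m_mem: "m s t \<in> space LH" by (simp add: m_def)
lemma d_mem: "d s \<in> space (LH \<otimes>\<^sub>V LH)" by (simp add: d_def)
lemma m_linear: "t \<in> space LH \<Longrightarrow> linear_map V LH f \<Longrightarrow> linear_map V LH (\<lambda>x. m (f x) t)"
   "linear_map V LH f \<Longrightarrow> linear_map V LH (\<lambda>x. m t (f x))"
  by (simp_all add: m_def)
lemma d_linear: "linear_map V LH f \<Longrightarrow> linear_map V (LH \<otimes>\<^sub>V LH) (\<lambda>x. d (f x))"
  by (simp add: d_def)
lemma e_linear: "linear_map V LH f \<Longrightarrow> linear_map V ground (\<lambda>x. e (f x))"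
  by (simp add: e_def)
lemmas [simp] = m_mem d_mem m_linear d_linear e_linear

abbreviation "one \<equiv> \<one>\<^bsub>L\<^esub> \<otimes>\<^bsub>L,H\<^esub> \<one>\<^bsub>H\<^esub>"

definition dm where
  "dm s t = sw LH LH (LH \<otimes>\<^sub>V LH) s (\<lambda>a b. sw LH LH (LH \<otimes>\<^sub>V LH) t (\<lambda>a' b'. m a a' \<otimes>\<^bsub>LH,LH\<^esub> m b b'))"

lemma one_mem: "one \<in> space LH"
  by simp

lemma smash_vspace: "vspace A"
  using vspace_tensor[OF vspace_HL(2), of H] by (simp add: vspace_def smash_same_vec)

lemma smash_algebra: "algebra A \<longleftrightarrow>
  (\<forall>x\<in>space LH. \<forall>y\<in>space LH. \<forall>z\<in>space LH. m (m x y) z = m x (m y z)) \<and>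
  (\<forall>x\<in>space LH. m one x = x \<and> m x one = x)"
proof -
  have "bilinear_map LH LH LH m" by (rule bilinear_mapI) (simp_all)
  then have "bilinear_map A A A (mul A)"
    by (auto simp: bilinear_map_def linear_map_def smash_same_vec smash_mul vspace_closed)
  then show ?thesis
    unfolding algebra_def smash_same_vec smash_unity
    by (simp add: smash_vspace one_mem smash_mul cong: ball_cong)
qed

lemma smash_coalgebra: "coalgebra A \<longleftrightarrow>
  (\<forall>x\<in>space LH. sw LH LH (LH \<otimes>\<^sub>V LH \<otimes>\<^sub>V LH) (d x) (\<lambda>a b. sw LH LH (LH \<otimes>\<^sub>V LH \<otimes>\<^sub>V LH) (d a) (\<lambda>a1 a2. pure\<^sub>3 LH LH LH a1 a2 b)) =
    sw LH LH (LH \<otimes>\<^sub>V LH \<otimes>\<^sub>V LH) (d x) (\<lambda>a b. sw LH LH (LH \<otimes>\<^sub>V LH \<otimes>\<^sub>V LH) (d b) (\<lambda>b1 b2. pure\<^sub>3 LH LH LH a b1 b2))) \<and>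
  (\<forall>x\<in>space LH. sw LH LH LH (d x) (\<lambda>a b. smul LH (e a) b) = x \<and> sw LH LH LH (d x) (\<lambda>a b. smul LH (e b) a) = x)"
proof -
  have 1: "linear_map A ground \<epsilon>\<^bsub>A\<^esub>"
    using linear_mapD[OF e_linear[OF linear_map_id]]
    by (auto simp: linear_map_def smash_same_vec smash_counit vspace_closed)
  have 2: "linear_map A (A \<otimes>\<^sub>V A) \<Delta>\<^bsub>A\<^esub>"
    using linear_mapD[OF d_linear[OF linear_map_id]]
    by (auto simp: linear_map_def smash_same_vec same_vec[OF smash_same_vec] smash_comul vspace_closed)
  \<comment> \<open>The outer pure tensor pairs \<open>A\<close> with a tensor square, so
    \<open>same_vec\<close>, which needs equal spaces on both sides, settles only the inner one. For
    the outer one the two spaces are exchanged one at a time.\<close>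
  have 3: "pure_tensor3 A A A = pure_tensor3 LH LH LH"
    by (simp add: fun_eq_iff pure_tensor3_def same_vec[OF smash_same_vec] pure_tensor_def
     bilinear_map_same_vec[OF smash_same_vec refl refl] bilinear_map_same_vec[OF refl refl smash_same_vec])
  show ?thesis
    unfolding coalgebra_def same_vec[OF smash_same_vec] smash_same_vec 3
    by (simp add: smash_vspace 1 2[unfolded same_vec[OF smash_same_vec]] smash_comul smash_counit sweedler_sw_types pure3_mem cong: ball_cong)
qed

text \<open>Only the counits of \<open>L\<close> and \<open>H\<close> at their units enter, so this
  bialgebra axiom puts no condition on \<open>R\<close> or \<open>W\<close>.\<close>

lemma e_one: "e one = 1"
  by (simp add: e_def sweedler_calc)

lemma smash_biproduct_iff: "smash_biproduct L H W R \<longleftrightarrow> algebra A \<and> coalgebra A \<and>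
   (\<forall>x\<in>space LH. \<forall>y\<in>space LH. d (m x y) = dm (d x) (d y)) \<and>
   d one = one \<otimes>\<^bsub>LH,LH\<^esub> one \<and>
   (\<forall>x\<in>space LH. \<forall>y\<in>space LH. e (m x y) = e x * e y)"
proof -
  have "tensor_mul A A (d x) (d y) = dm (d x) (d y)" for x y
    by (simp add: tensor_mul_def dm_def same_vec[OF smash_same_vec] smash_same_vec smash_mul sweedler_sw_types)
  then show ?thesis
    unfolding smash_biproduct_def bialgebra_def same_vec[OF smash_same_vec] smash_same_vec smash_unity
    by (simp add: smash_mul smash_comul smash_counit e_one cong: ball_cong)
qed

subsection \<open>The algebra structure\<close>

lemma normalD:
  assumes "normal H L R"
  shows "h \<in> space H \<Longrightarrow> R (h \<otimes>\<^bsub>H,L\<^esub> \<one>\<^bsub>L\<^esub>) = \<one>\<^bsub>L\<^esub> \<otimes>\<^bsub>L,H\<^esub> h"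
    and "l \<in> space L \<Longrightarrow> R (\<one>\<^bsub>H\<^esub> \<otimes>\<^bsub>H,L\<^esub> l) = l \<otimes>\<^bsub>L,H\<^esub> \<one>\<^bsub>H\<^esub>"
  using assms by (auto simp: normal_def)

lemma multiplicative_iff: "multiplicative H L R \<longleftrightarrow>
     (\<forall>h\<in>space H. \<forall>h'\<in>space H. \<forall>l\<in>space L.
        R ((h \<cdot>\<^bsub>H\<^esub> h') \<otimes>\<^bsub>H,L\<^esub> l) = sw L H LH (R (h' \<otimes>\<^bsub>H,L\<^esub> l)) (\<lambda>Rl Rh'.
        sw L H LH (R (h \<otimes>\<^bsub>H,L\<^esub> Rl)) (\<lambda>rRl rh. rRl \<otimes>\<^bsub>L,H\<^esub> (rh \<cdot>\<^bsub>H\<^esub> Rh')))) \<and>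
     (\<forall>h\<in>space H. \<forall>l\<in>space L. \<forall>l'\<in>space L.
        R (h \<otimes>\<^bsub>H,L\<^esub> (l \<cdot>\<^bsub>L\<^esub> l')) = sw L H LH (R (h \<otimes>\<^bsub>H,L\<^esub> l)) (\<lambda>Rl Rh.
        sw L H LH (R (Rh \<otimes>\<^bsub>H,L\<^esub> l')) (\<lambda>rl' rRh. (Rl \<cdot>\<^bsub>L\<^esub> rl') \<otimes>\<^bsub>L,H\<^esub> rRh)))"
  unfolding multiplicative_def by (simp add: sweedler_sw_types cong: ball_cong)

lemma m_pure: "l \<in> space L \<Longrightarrow> h \<in> space H \<Longrightarrow> l' \<in> space L \<Longrightarrow> h' \<in> space H \<Longrightarrow>
  m (l \<otimes>\<^bsub>L,H\<^esub> h) (l' \<otimes>\<^bsub>L,H\<^esub> h') = sw L H LH (R (h \<otimes>\<^bsub>H,L\<^esub> l')) (\<lambda>Rl' Rh. (l \<cdot>\<^bsub>L\<^esub> Rl') \<otimes>\<^bsub>L,H\<^esub> (Rh \<cdot>\<^bsub>H\<^esub> h'))"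
  by (simp add: m_def sw_pure)

text \<open>A unit of \<open>L\<close> on the left and a unit of \<open>H\<close> on the right
  reduce the product formula to \<open>R\<close> itself. The right unit law at
  \<open>1 \<otimes> h\<close> and the left unit law at \<open>l \<otimes> 1\<close> are therefore
  the two halves of normality.\<close>

lemma normal_iff: "normal H L R \<longleftrightarrow> (\<forall>x\<in>space LH. m one x = x \<and> m x one = x)"
proof
  assume "normal H L R"
  note R1 = normalD[OF this]
  show "\<forall>x\<in>space LH. m one x = x \<and> m x one = x"
    by (simp add: m_def sweedler_calc R1)
next
  assume *: "\<forall>x\<in>space LH. m one x = x \<and> m x one = x"
  have "R (h \<otimes>\<^bsub>H,L\<^esub> \<one>\<^bsub>L\<^esub>) = \<one>\<^bsub>L\<^esub> \<otimes>\<^bsub>L,H\<^esub> h" if "h \<in> space H" for h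
  proof -
    have "m (\<one>\<^bsub>L\<^esub> \<otimes>\<^bsub>L,H\<^esub> h) one = R (h \<otimes>\<^bsub>H,L\<^esub> \<one>\<^bsub>L\<^esub>)"
      using that by (simp add: m_pure sweedler_calc)
    then show ?thesis using * that by simp
  qed
  moreover
  have "R (\<one>\<^bsub>H\<^esub> \<otimes>\<^bsub>H,L\<^esub> l) = l \<otimes>\<^bsub>L,H\<^esub> \<one>\<^bsub>H\<^esub>" if "l \<in> space L" for l
  proof -
    have "m one (l \<otimes>\<^bsub>L,H\<^esub> \<one>\<^bsub>H\<^esub>) = R (\<one>\<^bsub>H\<^esub> \<otimes>\<^bsub>H,L\<^esub> l)"
      using that by (simp add: m_pure sweedler_calc)
    then show ?thesis using * that by simp
  qed
  ultimately show "normal H L R" by (simp add: normal_def)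
qed

lemma algebra_iff: "algebra A \<longleftrightarrow> normal H L R \<and> multiplicative H L R"
proof
  assume *: "algebra A"
  then have n: "normal H L R" unfolding normal_iff smash_algebra by blast
  note R1 = normalD[OF this]
  have assoc: "m (m x y) z = m x (m y z)" if "x \<in> space LH" "y \<in> space LH" "z \<in> space LH" for x y z
    using * that unfolding smash_algebra by blast
  have "R ((h \<cdot>\<^bsub>H\<^esub> h') \<otimes>\<^bsub>H,L\<^esub> l) = sw L H LH (R (h' \<otimes>\<^bsub>H,L\<^esub> l)) (\<lambda>Rl Rh'.
        sw L H LH (R (h \<otimes>\<^bsub>H,L\<^esub> Rl)) (\<lambda>rRl rh. rRl \<otimes>\<^bsub>L,H\<^esub> (rh \<cdot>\<^bsub>H\<^esub> Rh')))"
    if "h \<in> space H" "h' \<in> space H" "l \<in> space L" for h h' l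
    using that assoc[of "\<one>\<^bsub>L\<^esub> \<otimes>\<^bsub>L,H\<^esub> h" "\<one>\<^bsub>L\<^esub> \<otimes>\<^bsub>L,H\<^esub> h'" "l \<otimes>\<^bsub>L,H\<^esub> \<one>\<^bsub>H\<^esub>"]
    by (simp add: m_def sweedler_calc R1)
  moreover have "R (h \<otimes>\<^bsub>H,L\<^esub> (l \<cdot>\<^bsub>L\<^esub> l')) = sw L H LH (R (h \<otimes>\<^bsub>H,L\<^esub> l)) (\<lambda>Rl Rh.
        sw L H LH (R (Rh \<otimes>\<^bsub>H,L\<^esub> l')) (\<lambda>rl' rRh. (Rl \<cdot>\<^bsub>L\<^esub> rl') \<otimes>\<^bsub>L,H\<^esub> rRh))"
    if "h \<in> space H" "l \<in> space L" "l' \<in> space L" for h l l'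
    using that assoc[of "\<one>\<^bsub>L\<^esub> \<otimes>\<^bsub>L,H\<^esub> h" "l \<otimes>\<^bsub>L,H\<^esub> \<one>\<^bsub>H\<^esub>" "l' \<otimes>\<^bsub>L,H\<^esub> \<one>\<^bsub>H\<^esub>"]
    by (simp add: m_def sweedler_calc R1)
  ultimately show "normal H L R \<and> multiplicative H L R"
    using n by (simp add: multiplicative_iff)
next
  assume *: "normal H L R \<and> multiplicative H L R"
  then have Rm: "R ((h \<cdot>\<^bsub>H\<^esub> h') \<otimes>\<^bsub>H,L\<^esub> l) = sw L H LH (R (h' \<otimes>\<^bsub>H,L\<^esub> l)) (\<lambda>Rl Rh'.
        sw L H LH (R (h \<otimes>\<^bsub>H,L\<^esub> Rl)) (\<lambda>rRl rh. rRl \<otimes>\<^bsub>L,H\<^esub> (rh \<cdot>\<^bsub>H\<^esub> Rh')))"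
    if "h \<in> space H" "h' \<in> space H" "l \<in> space L" for h h' l
    using that unfolding multiplicative_iff by blast
  from * have Rm': "R (h \<otimes>\<^bsub>H,L\<^esub> (l \<cdot>\<^bsub>L\<^esub> l')) = sw L H LH (R (h \<otimes>\<^bsub>H,L\<^esub> l)) (\<lambda>Rl Rh.
        sw L H LH (R (Rh \<otimes>\<^bsub>H,L\<^esub> l')) (\<lambda>rl' rRh. (Rl \<cdot>\<^bsub>L\<^esub> rl') \<otimes>\<^bsub>L,H\<^esub> rRh))"
    if "h \<in> space H" "l \<in> space L" "l' \<in> space L" for h l l'
    using that unfolding multiplicative_iff by blast
  \<comment> \<open>For pure tensors with entries \<open>l, h\<close>, \<open>l', h'\<close> and
    \<open>l'', h''\<close>, both sides become a sum over \<open>R (h \<otimes> l')\<close> and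
    \<open>R (h' \<otimes> l'')\<close>, followed by \<open>R\<close> on the \<open>H\<close>-part
    of the former and the \<open>L\<close>-part of the latter. Only the order of the first two sums
    differs.\<close>
  have "m (m x y) z = m x (m y z)" if "x \<in> space LH" "y \<in> space LH" "z \<in> space LH" for x y z
    using that
    apply (simp add: m_def sweedler_calc Rm Rm')
    by (rule sw_sort)+
  then show "algebra A"
    using * unfolding smash_algebra normal_iff by blast
qed

subsection \<open>The coalgebra structure\<close>

lemma conormal_iff: "conormal H L W \<longleftrightarrow>
     (\<forall>l\<in>space L. \<forall>h\<in>space H.
        sw H L H (W (l \<otimes>\<^bsub>L,H\<^esub> h)) (\<lambda>Wh Wl. smul H (\<epsilon>\<^bsub>L\<^esub> Wl) Wh) = smul H (\<epsilon>\<^bsub>L\<^esub> l) h \<and>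
        sw H L L (W (l \<otimes>\<^bsub>L,H\<^esub> h)) (\<lambda>Wh Wl. smul L (\<epsilon>\<^bsub>H\<^esub> Wh) Wl) = smul L (\<epsilon>\<^bsub>H\<^esub> h) l)"
  unfolding conormal_def by (simp add: sweedler_sw_types cong: ball_cong)

lemma conormal_sw:
  assumes "conormal H L W" "l \<in> space L" "h \<in> space H" "vspace V"
  shows "linear_map H V F \<Longrightarrow>
      sw H L V (W (l \<otimes>\<^bsub>L,H\<^esub> h)) (\<lambda>Wh Wl. smul V (\<epsilon>\<^bsub>L\<^esub> Wl) (F Wh)) = smul V (\<epsilon>\<^bsub>L\<^esub> l) (F h)"
    and "linear_map L V G \<Longrightarrow>
      sw H L V (W (l \<otimes>\<^bsub>L,H\<^esub> h)) (\<lambda>Wh Wl. smul V (\<epsilon>\<^bsub>H\<^esub> Wh) (G Wl)) = smul V (\<epsilon>\<^bsub>H\<^esub> h) (G l)"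
proof -
  assume F: "linear_map H V F"
  have "sw H L H (W (l \<otimes>\<^bsub>L,H\<^esub> h)) (\<lambda>Wh Wl. smul H (\<epsilon>\<^bsub>L\<^esub> Wl) Wh) = smul H (\<epsilon>\<^bsub>L\<^esub> l) h"
    using assms by (simp add: conormal_iff)
  from arg_cong[OF this, of F]
  show "sw H L V (W (l \<otimes>\<^bsub>L,H\<^esub> h)) (\<lambda>Wh Wl. smul V (\<epsilon>\<^bsub>L\<^esub> Wl) (F Wh)) = smul V (\<epsilon>\<^bsub>L\<^esub> l) (F h)"
    using assms by (simp add: linear_map_sw[OF F] linear_mapD(3)[OF F])
next
  assume G: "linear_map L V G"
  have "sw H L L (W (l \<otimes>\<^bsub>L,H\<^esub> h)) (\<lambda>Wh Wl. smul L (\<epsilon>\<^bsub>H\<^esub> Wh) Wl) = smul L (\<epsilon>\<^bsub>H\<^esub> h) l"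
    using assms by (simp add: conormal_iff)
  from arg_cong[OF this, of G]
  show "sw H L V (W (l \<otimes>\<^bsub>L,H\<^esub> h)) (\<lambda>Wh Wl. smul V (\<epsilon>\<^bsub>H\<^esub> Wh) (G Wl)) = smul V (\<epsilon>\<^bsub>H\<^esub> h) (G l)"
    using assms by (simp add: linear_map_sw[OF G] linear_mapD(3)[OF G])
qed

text \<open>In the right counit law, \<open>e\<close> removes \<open>h2\<close> and applies the
  counit of \<open>L\<close> to the output of \<open>W\<close>; a further counit on the surviving
  \<open>l1\<close> restores \<open>l\<close> and leaves the first half of conormality. The second
  half comes from the left counit law and the counit on \<open>h2\<close>.\<close>

lemma conormal_iff_counit: "conormal H L W \<longleftrightarrow>
  (\<forall>x\<in>space LH. sw LH LH LH (d x) (\<lambda>a b. smul LH (e a) b) = x \<and> sw LH LH LH (d x) (\<lambda>a b. smul LH (e b) a) = x)"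
proof
  assume *: "conormal H L W"
  show "\<forall>x\<in>space LH. sw LH LH LH (d x) (\<lambda>a b. smul LH (e a) b) = x \<and> sw LH LH LH (d x) (\<lambda>a b. smul LH (e b) a) = x"
    by (simp add: d_def e_def sweedler_calc conormal_sw[OF *] counit_left counit_right)
next
  assume *: "\<forall>x\<in>space LH. sw LH LH LH (d x) (\<lambda>a b. smul LH (e a) b) = x \<and> sw LH LH LH (d x) (\<lambda>a b. smul LH (e b) a) = x"
  have "sw H L H (W (l \<otimes>\<^bsub>L,H\<^esub> h)) (\<lambda>Wh Wl. smul H (\<epsilon>\<^bsub>L\<^esub> Wl) Wh) = smul H (\<epsilon>\<^bsub>L\<^esub> l) h"
    if "l \<in> space L" "h \<in> space H" for l h
  proof -
    have "sw LH LH LH (d (l \<otimes>\<^bsub>L,H\<^esub> h)) (\<lambda>a b. smul LH (e b) a) = l \<otimes>\<^bsub>L,H\<^esub> h"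
      using * that by simp
    from arg_cong[OF this, of "\<lambda>t. sw L H H t (\<lambda>l h. smul H (\<epsilon>\<^bsub>L\<^esub> l) h)"] show ?thesis
      using that by (simp add: d_def e_def sweedler_calc counit_left counit_right)
  qed
  moreover
  have "sw H L L (W (l \<otimes>\<^bsub>L,H\<^esub> h)) (\<lambda>Wh Wl. smul L (\<epsilon>\<^bsub>H\<^esub> Wh) Wl) = smul L (\<epsilon>\<^bsub>H\<^esub> h) l"
    if "l \<in> space L" "h \<in> space H" for l h
  proof -
    have "sw LH LH LH (d (l \<otimes>\<^bsub>L,H\<^esub> h)) (\<lambda>a b. smul LH (e a) b) = l \<otimes>\<^bsub>L,H\<^esub> h"
      using * that by simp
    from arg_cong[OF this, of "\<lambda>t. sw L H L t (\<lambda>l h. smul L (\<epsilon>\<^bsub>H\<^esub> h) l)"] show ?thesis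
      using that by (simp add: d_def e_def sweedler_calc counit_left counit_right)
  qed
  ultimately show "conormal H L W" by (simp add: conormal_iff)
qed

section \<open>Comultiplicativity and coassociativity\<close>

lemma comultiplicative_iff: "comultiplicative H L W \<longleftrightarrow>
     (\<forall>l\<in>space L. \<forall>h\<in>space H.
        sw H L (H \<otimes>\<^sub>V H \<otimes>\<^sub>V L) (W (l \<otimes>\<^bsub>L,H\<^esub> h)) (\<lambda>Wh Wl.
        sw H H (H \<otimes>\<^sub>V H \<otimes>\<^sub>V L) (\<Delta>\<^bsub>H\<^esub> Wh) (\<lambda>Wh1 Wh2. pure\<^sub>3 H H L Wh1 Wh2 Wl)) =
        sw H H (H \<otimes>\<^sub>V H \<otimes>\<^sub>V L) (\<Delta>\<^bsub>H\<^esub> h) (\<lambda>h1 h2.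
        sw H L (H \<otimes>\<^sub>V H \<otimes>\<^sub>V L) (W (l \<otimes>\<^bsub>L,H\<^esub> h1)) (\<lambda>Wh1 Wl.
        sw H L (H \<otimes>\<^sub>V H \<otimes>\<^sub>V L) (W (Wl \<otimes>\<^bsub>L,H\<^esub> h2)) (\<lambda>Uh2 UWl. pure\<^sub>3 H H L Wh1 Uh2 UWl)))) \<and>
     (\<forall>l\<in>space L. \<forall>h\<in>space H.
        sw H L (H \<otimes>\<^sub>V L \<otimes>\<^sub>V L) (W (l \<otimes>\<^bsub>L,H\<^esub> h)) (\<lambda>Wh Wl.
        sw L L (H \<otimes>\<^sub>V L \<otimes>\<^sub>V L) (\<Delta>\<^bsub>L\<^esub> Wl) (\<lambda>Wl1 Wl2. pure\<^sub>3 H L L Wh Wl1 Wl2)) =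
        sw L L (H \<otimes>\<^sub>V L \<otimes>\<^sub>V L) (\<Delta>\<^bsub>L\<^esub> l) (\<lambda>l1 l2.
        sw H L (H \<otimes>\<^sub>V L \<otimes>\<^sub>V L) (W (l2 \<otimes>\<^bsub>L,H\<^esub> h)) (\<lambda>Wh Wl2.
        sw H L (H \<otimes>\<^sub>V L \<otimes>\<^sub>V L) (W (l1 \<otimes>\<^bsub>L,H\<^esub> Wh)) (\<lambda>UWh Ul1. pure\<^sub>3 H L L UWh Ul1 Wl2))))"
  unfolding comultiplicative_def by (simp add: sweedler_sw_types cong: ball_cong)

text \<open>Comultiplicativity tested against a trilinear \<open>F\<close> by \<open>lift3\<close>.
  From left to right it moves a comultiplication from the output of \<open>W\<close> to its input,
  so that in the end only given elements are comultiplied.\<close>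

lemma comultiplicative_sw1:
  assumes "comultiplicative H L W" "l \<in> space L" "h \<in> space H" "vspace V"
    and F: "\<And>b c. b \<in> space H \<Longrightarrow> c \<in> space L \<Longrightarrow> linear_map H V (\<lambda>a. F a b c)"
    "\<And>a c. a \<in> space H \<Longrightarrow> c \<in> space L \<Longrightarrow> linear_map H V (\<lambda>b. F a b c)"
    "\<And>a b. a \<in> space H \<Longrightarrow> b \<in> space H \<Longrightarrow> linear_map L V (\<lambda>c. F a b c)"
  shows "sw H L V (W (l \<otimes>\<^bsub>L,H\<^esub> h)) (\<lambda>Wh Wl. sw H H V (\<Delta>\<^bsub>H\<^esub> Wh) (\<lambda>Wh1 Wh2. F Wh1 Wh2 Wl)) =
    sw H H V (\<Delta>\<^bsub>H\<^esub> h) (\<lambda>h1 h2. sw H L V (W (l \<otimes>\<^bsub>L,H\<^esub> h1)) (\<lambda>Wh1 Wl.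
      sw H L V (W (Wl \<otimes>\<^bsub>L,H\<^esub> h2)) (\<lambda>Uh2 UWl. F Wh1 Uh2 UWl)))"
proof -
  note * = assms(1)[unfolded comultiplicative_iff, THEN conjunct1, rule_format, OF assms(2,3)]
  from arg_cong[OF *, of "\<lambda>t. sw H (H \<otimes>\<^sub>V L) V t (\<lambda>a u. sw H L V u (F a))"] show ?thesis
    by (simp add: assms(2-) F pure3_mem linear_map_sw[OF lift3(1)] lift3(2))
qed

lemma comultiplicative_sw2:
  assumes "comultiplicative H L W" "l \<in> space L" "h \<in> space H" "vspace V"
    and F: "\<And>b c. b \<in> space L \<Longrightarrow> c \<in> space L \<Longrightarrow> linear_map H V (\<lambda>a. F a b c)"
    "\<And>a c. a \<in> space H \<Longrightarrow> c \<in> space L \<Longrightarrow> linear_map L V (\<lambda>b. F a b c)"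
    "\<And>a b. a \<in> space H \<Longrightarrow> b \<in> space L \<Longrightarrow> linear_map L V (\<lambda>c. F a b c)"
  shows "sw H L V (W (l \<otimes>\<^bsub>L,H\<^esub> h)) (\<lambda>Wh Wl. sw L L V (\<Delta>\<^bsub>L\<^esub> Wl) (\<lambda>Wl1 Wl2. F Wh Wl1 Wl2)) =
    sw L L V (\<Delta>\<^bsub>L\<^esub> l) (\<lambda>l1 l2. sw H L V (W (l2 \<otimes>\<^bsub>L,H\<^esub> h)) (\<lambda>Wh Wl2.
      sw H L V (W (l1 \<otimes>\<^bsub>L,H\<^esub> Wh)) (\<lambda>UWh Ul1. F UWh Ul1 Wl2)))"
proof -
  note * = assms(1)[unfolded comultiplicative_iff, THEN conjunct2, rule_format, OF assms(2,3)]
  from arg_cong[OF *, of "\<lambda>t. sw H (L \<otimes>\<^sub>V L) V t (\<lambda>a u. sw L L V u (F a))"] show ?thesis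
    by (simp add: assms(2-) F pure3_mem linear_map_sw[OF lift3(1)] lift3(2))
qed

abbreviation "LH3 \<equiv> LH \<otimes>\<^sub>V LH \<otimes>\<^sub>V LH"

lemma comultiplicative_imp_coassoc:
  assumes c: "comultiplicative H L W" and x: "x \<in> space LH"
  shows "sw LH LH LH3 (d x) (\<lambda>a b. sw LH LH LH3 (d a) (\<lambda>a1 a2. pure\<^sub>3 LH LH LH a1 a2 b)) =
    sw LH LH LH3 (d x) (\<lambda>a b. sw LH LH LH3 (d b) (\<lambda>b1 b2. pure\<^sub>3 LH LH LH a b1 b2))"
proof -
  \<comment> \<open>In this order of sums the comultiplication of \<open>l1\<close> stands directly
    under that of \<open>l\<close>, and the comultiplication of \<open>a\<close> directly under the
    \<open>W\<close> that produces \<open>a\<close>. These are the patterns of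
    \<open>coassoc\<close> and \<open>comultiplicative_sw1\<close>.\<close>
  have "sw LH LH LH3 (d x) (\<lambda>a b. sw LH LH LH3 (d a) (\<lambda>a1 a2. pure\<^sub>3 LH LH LH a1 a2 b)) =
    sw L H LH3 x (\<lambda>l h. sw L L LH3 (\<Delta>\<^bsub>L\<^esub> l) (\<lambda>l1 l2. sw L L LH3 (\<Delta>\<^bsub>L\<^esub> l1) (\<lambda>l11 l12.
      sw H H LH3 (\<Delta>\<^bsub>H\<^esub> h) (\<lambda>h1 h2. sw H L LH3 (W (l2 \<otimes>\<^bsub>L,H\<^esub> h1)) (\<lambda>a b.
      sw H H LH3 (\<Delta>\<^bsub>H\<^esub> a) (\<lambda>p q. sw H L LH3 (W (l12 \<otimes>\<^bsub>L,H\<^esub> p)) (\<lambda>u v.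
      pure\<^sub>3 LH LH LH (l11 \<otimes>\<^bsub>L,H\<^esub> u) (v \<otimes>\<^bsub>L,H\<^esub> q) (b \<otimes>\<^bsub>L,H\<^esub> h2))))))))"
    by (simp add: d_def sweedler_calc pure_tensor3_def) (rule sw_sort)+
  also have "\<dots> = sw LH LH LH3 (d x) (\<lambda>a b. sw LH LH LH3 (d b) (\<lambda>b1 b2. pure\<^sub>3 LH LH LH a b1 b2))"
    by (simp add: d_def sweedler_calc pure_tensor3_def comultiplicative_sw1[OF c] comultiplicative_sw2[OF c] coassoc) (rule sw_sort)+
  finally show ?thesis .
qed

text \<open>Coassociativity is an identity in six factors; counits on three of them leave
  \<open>H, H, L\<close> for the first law and \<open>H, L, L\<close> for the second. Each side
  contains two applications of \<open>W\<close>. Conormality cancels the second one on the left for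
  the first law, on the right for the second law, and what remains there is a comultiplied value of
  \<open>W\<close>.\<close>

lemma coassoc_imp_comultiplicative:
  assumes *: "\<And>x. x \<in> space LH \<Longrightarrow> sw LH LH LH3 (d x) (\<lambda>a b. sw LH LH LH3 (d a) (\<lambda>a1 a2. pure\<^sub>3 LH LH LH a1 a2 b)) =
    sw LH LH LH3 (d x) (\<lambda>a b. sw LH LH LH3 (d b) (\<lambda>b1 b2. pure\<^sub>3 LH LH LH a b1 b2))" and c: "conormal H L W"
  shows "comultiplicative H L W"
proof -
  let ?V = "H \<otimes>\<^sub>V H \<otimes>\<^sub>V L"
  have "sw H L ?V (W (l \<otimes>\<^bsub>L,H\<^esub> h)) (\<lambda>Wh Wl.
        sw H H ?V (\<Delta>\<^bsub>H\<^esub> Wh) (\<lambda>Wh1 Wh2. pure\<^sub>3 H H L Wh1 Wh2 Wl)) =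
        sw H H ?V (\<Delta>\<^bsub>H\<^esub> h) (\<lambda>h1 h2.
        sw H L ?V (W (l \<otimes>\<^bsub>L,H\<^esub> h1)) (\<lambda>Wh1 Wl.
        sw H L ?V (W (Wl \<otimes>\<^bsub>L,H\<^esub> h2)) (\<lambda>Uh2 UWl. pure\<^sub>3 H H L Wh1 Uh2 UWl)))"
    if "l \<in> space L" "h \<in> space H" for l h
    using arg_cong[OF *[of "l \<otimes>\<^bsub>L,H\<^esub> h"], of "\<lambda>t. sw LH (LH \<otimes>\<^sub>V LH) ?V t (\<lambda>a u.
      sw LH LH ?V u (\<lambda>b c. sw L H ?V a (\<lambda>l1 h1. sw L H ?V b (\<lambda>l2 h2. sw L H ?V c (\<lambda>l3 h3.
      smul ?V (\<epsilon>\<^bsub>L\<^esub> l1) (smul ?V (\<epsilon>\<^bsub>L\<^esub> l2) (smul ?V (\<epsilon>\<^bsub>H\<^esub> h3) (pure\<^sub>3 H H L h1 h2 l3))))))))"] that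
    by (simp add: d_def sweedler_calc pure_tensor3_def conormal_sw[OF c] counit_left counit_right)
  moreover
  let ?V = "H \<otimes>\<^sub>V L \<otimes>\<^sub>V L"
  have "sw H L ?V (W (l \<otimes>\<^bsub>L,H\<^esub> h)) (\<lambda>Wh Wl.
        sw L L ?V (\<Delta>\<^bsub>L\<^esub> Wl) (\<lambda>Wl1 Wl2. pure\<^sub>3 H L L Wh Wl1 Wl2)) =
        sw L L ?V (\<Delta>\<^bsub>L\<^esub> l) (\<lambda>l1 l2.
        sw H L ?V (W (l2 \<otimes>\<^bsub>L,H\<^esub> h)) (\<lambda>Wh Wl2.
        sw H L ?V (W (l1 \<otimes>\<^bsub>L,H\<^esub> Wh)) (\<lambda>UWh Ul1. pure\<^sub>3 H L L UWh Ul1 Wl2)))"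
    if "l \<in> space L" "h \<in> space H" for l h
    using arg_cong[OF *[of "l \<otimes>\<^bsub>L,H\<^esub> h"], of "\<lambda>t. sw LH (LH \<otimes>\<^sub>V LH) ?V t (\<lambda>a u.
      sw LH LH ?V u (\<lambda>b c. sw L H ?V a (\<lambda>l1 h1. sw L H ?V b (\<lambda>l2 h2. sw L H ?V c (\<lambda>l3 h3.
      smul ?V (\<epsilon>\<^bsub>L\<^esub> l1) (smul ?V (\<epsilon>\<^bsub>H\<^esub> h2) (smul ?V (\<epsilon>\<^bsub>H\<^esub> h3) (pure\<^sub>3 H L L h1 l2 l3))))))))"] that
    by (simp add: d_def sweedler_calc pure_tensor3_def conormal_sw[OF c] counit_left counit_right)
  ultimately show ?thesis by (simp add: comultiplicative_iff)
qed

lemma coalgebra_iff: "coalgebra A \<longleftrightarrow> conormal H L W \<and> comultiplicative H L W"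
  unfolding smash_coalgebra conormal_iff_counit[symmetric]
  using coassoc_imp_comultiplicative comultiplicative_imp_coassoc by blast

subsection \<open>Compatibility\<close>

abbreviation i where "i l \<equiv> l \<otimes>\<^bsub>L,H\<^esub> \<one>\<^bsub>H\<^esub>"
abbreviation j where "j h \<equiv> \<one>\<^bsub>L\<^esub> \<otimes>\<^bsub>L,H\<^esub> h"
abbreviation "LH2 \<equiv> LH \<otimes>\<^sub>V LH"

section \<open>Multiplicativity of the comultiplication, reduced to generators\<close>

lemma dm_mem [simp]: "dm s t \<in> space LH2"
  by (simp add: dm_def)

lemma d_pure: "l \<in> space L \<Longrightarrow> h \<in> space H \<Longrightarrow> d (l \<otimes>\<^bsub>L,H\<^esub> h) =
  sw L L LH2 (\<Delta>\<^bsub>L\<^esub> l) (\<lambda>l1 l2. sw H H LH2 (\<Delta>\<^bsub>H\<^esub> h) (\<lambda>h1 h2. sw H L LH2 (W (l2 \<otimes>\<^bsub>L,H\<^esub> h1)) (\<lambda>Wh1 Wl2.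
          (l1 \<otimes>\<^bsub>L,H\<^esub> Wh1) \<otimes>\<^bsub>LH,LH\<^esub> (Wl2 \<otimes>\<^bsub>L,H\<^esub> h2))))"
  by (simp add: d_def sweedler_calc)

lemma dm_linear:
   "t \<in> space LH2 \<Longrightarrow> linear_map V LH2 f \<Longrightarrow> linear_map V LH2 (\<lambda>x. dm (f x) t)"
   "linear_map V LH2 f \<Longrightarrow> linear_map V LH2 (\<lambda>x. dm t (f x))"
  by (simp_all add: dm_def)
declare dm_linear [simp]

lemma m_sw:
  assumes "\<And>a b. a \<in> space B \<Longrightarrow> b \<in> space C \<Longrightarrow> f a b \<in> space LH"
  shows "m s (sw B C LH t f) = sw B C LH t (\<lambda>a b. m s (f a b))"
    and "s \<in> space LH \<Longrightarrow> m (sw B C LH t f) s = sw B C LH t (\<lambda>a b. m (f a b) s)"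
  by (rule linear_map_sw[where g = "m s"]; simp add: assms) (rule linear_map_sw[where g = "\<lambda>x. m x s"]; simp add: assms)

lemma dm_sw:
  assumes "\<And>a b. a \<in> space B \<Longrightarrow> b \<in> space C \<Longrightarrow> f a b \<in> space LH2"
  shows "dm s (sw B C LH2 t f) = sw B C LH2 t (\<lambda>a b. dm s (f a b))"
    and "s \<in> space LH2 \<Longrightarrow> dm (sw B C LH2 t f) s = sw B C LH2 t (\<lambda>a b. dm (f a b) s)"
  by (rule linear_map_sw[where g = "dm s"]; simp add: assms) (rule linear_map_sw[where g = "\<lambda>x. dm x s"]; simp add: assms)

lemma d_sw:
  assumes "\<And>a b. a \<in> space B \<Longrightarrow> b \<in> space C \<Longrightarrow> f a b \<in> space LH"
  shows "d (sw B C LH t f) = sw B C LH2 t (\<lambda>a b. d (f a b))"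
  by (rule linear_map_sw[where g = d]; simp add: assms)

lemma dm_assoc:
  assumes "algebra A" "s \<in> space LH2" "t \<in> space LH2" "u \<in> space LH2"
  shows "dm (dm s t) u = dm s (dm t u)"
proof -
  have assoc: "m (m x y) z = m x (m y z)" if "x \<in> space LH" "y \<in> space LH" "z \<in> space LH" for x y z
    using assms(1) that unfolding smash_algebra by blast
  show ?thesis
    by (simp add: dm_def sweedler_calc assoc)
qed

lemma m_factor:
  assumes "normal H L R" "l \<in> space L" "h \<in> space H"
  shows "m (i l) (j h) = l \<otimes>\<^bsub>L,H\<^esub> h"
  using assms by (simp add: m_pure normalD sweedler_calc)

text \<open>The product of \<open>l \<otimes> h\<close> and \<open>l' \<otimes> h'\<close> is
  \<open>i l\<close>, times \<open>R (h \<otimes> l')\<close>, times \<open>j h'\<close>. The first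
  three conditions split off the outer factors under \<open>d\<close>; the fourth evaluates
  \<open>d\<close> on the middle one, where \<open>R\<close> has exchanged the generators.\<close>

lemma d_mult_iff:
  assumes A: "algebra A"
  shows "(\<forall>x\<in>space LH. \<forall>y\<in>space LH. d (m x y) = dm (d x) (d y)) \<longleftrightarrow>
    (\<forall>l\<in>space L. \<forall>h\<in>space H. d (l \<otimes>\<^bsub>L,H\<^esub> h) = dm (d (i l)) (d (j h))) \<and>
    (\<forall>l\<in>space L. \<forall>l'\<in>space L. d (i (l \<cdot>\<^bsub>L\<^esub> l')) = dm (d (i l)) (d (i l'))) \<and>
    (\<forall>h\<in>space H. \<forall>h'\<in>space H. d (j (h \<cdot>\<^bsub>H\<^esub> h')) = dm (d (j h)) (d (j h'))) \<and>
    (\<forall>h\<in>space H. \<forall>l\<in>space L. d (R (h \<otimes>\<^bsub>H,L\<^esub> l)) = dm (d (j h)) (d (i l)))"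
    (is "?M \<longleftrightarrow> ?D")
proof
  have n: "normal H L R" using A by (simp add: algebra_iff)
  note R1 = normalD[OF n]
  have prods: "l \<in> space L \<Longrightarrow> l' \<in> space L \<Longrightarrow> m (i l) (i l') = i (l \<cdot>\<^bsub>L\<^esub> l')"
    "h \<in> space H \<Longrightarrow> h' \<in> space H \<Longrightarrow> m (j h) (j h') = j (h \<cdot>\<^bsub>H\<^esub> h')"
    "h \<in> space H \<Longrightarrow> l \<in> space L \<Longrightarrow> m (j h) (i l) = R (h \<otimes>\<^bsub>H,L\<^esub> l)" for l l' h h'
    by (simp_all add: m_pure R1 sweedler_calc)
  { assume M: ?M
    have "d (l \<otimes>\<^bsub>L,H\<^esub> h) = dm (d (i l)) (d (j h))" if "l \<in> space L" "h \<in> space H" for l h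
      using M[rule_format, of "i l" "j h"] that by (simp add: m_factor[OF n])
    moreover have "d (i (l \<cdot>\<^bsub>L\<^esub> l')) = dm (d (i l)) (d (i l'))" if "l \<in> space L" "l' \<in> space L" for l l'
      using M[rule_format, of "i l" "i l'"] that by (simp add: prods(1))
    moreover have "d (j (h \<cdot>\<^bsub>H\<^esub> h')) = dm (d (j h)) (d (j h'))" if "h \<in> space H" "h' \<in> space H" for h h'
      using M[rule_format, of "j h" "j h'"] that by (simp add: prods(2))
    moreover have "d (R (h \<otimes>\<^bsub>H,L\<^esub> l)) = dm (d (j h)) (d (i l))" if "h \<in> space H" "l \<in> space L" for h l
      using M[rule_format, of "j h" "i l"] that by (simp add: prods(3))
    ultimately show ?D by blast }
  assume D: ?D
  then have D1: "d (l \<otimes>\<^bsub>L,H\<^esub> h) = dm (d (i l)) (d (j h))" if "l \<in> space L" "h \<in> space H" for l h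
    using that by blast
  from D have D2: "d (i (l \<cdot>\<^bsub>L\<^esub> l')) = dm (d (i l)) (d (i l'))" if "l \<in> space L" "l' \<in> space L" for l l'
    using that by blast
  from D have D3: "d (j (h \<cdot>\<^bsub>H\<^esub> h')) = dm (d (j h)) (d (j h'))" if "h \<in> space H" "h' \<in> space H" for h h'
    using that by blast
  from D have D4: "d (R (h \<otimes>\<^bsub>H,L\<^esub> l)) = dm (d (j h)) (d (i l))" if "h \<in> space H" "l \<in> space L" for h l
    using that by blast
  have pure: "d (m (l \<otimes>\<^bsub>L,H\<^esub> h) (l' \<otimes>\<^bsub>L,H\<^esub> h')) = dm (d (l \<otimes>\<^bsub>L,H\<^esub> h)) (d (l' \<otimes>\<^bsub>L,H\<^esub> h'))"
    if mem: "l \<in> space L" "h \<in> space H" "l' \<in> space L" "h' \<in> space H" for l h l' h'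
  proof -
    have "d (m (l \<otimes>\<^bsub>L,H\<^esub> h) (l' \<otimes>\<^bsub>L,H\<^esub> h')) =
      sw L H LH2 (R (h \<otimes>\<^bsub>H,L\<^esub> l')) (\<lambda>u v. d ((l \<cdot>\<^bsub>L\<^esub> u) \<otimes>\<^bsub>L,H\<^esub> (v \<cdot>\<^bsub>H\<^esub> h')))"
      using mem by (simp add: m_pure d_sw)
    also have "\<dots> = sw L H LH2 (R (h \<otimes>\<^bsub>H,L\<^esub> l')) (\<lambda>u v. dm (d (i l)) (dm (d (u \<otimes>\<^bsub>L,H\<^esub> v)) (d (j h'))))"
    proof (rule sw_cong[OF refl])
      fix u v assume "u \<in> space L" "v \<in> space H"
      then show "d ((l \<cdot>\<^bsub>L\<^esub> u) \<otimes>\<^bsub>L,H\<^esub> (v \<cdot>\<^bsub>H\<^esub> h')) = dm (d (i l)) (dm (d (u \<otimes>\<^bsub>L,H\<^esub> v)) (d (j h')))"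
        using mem by (subst (1 2) D1) (simp_all add: D2 D3 dm_assoc[OF A])
    qed
    also have "\<dots> = dm (d (i l)) (dm (sw L H LH2 (R (h \<otimes>\<^bsub>H,L\<^esub> l')) (\<lambda>u v. d (u \<otimes>\<^bsub>L,H\<^esub> v))) (d (j h')))"
      by (simp add: dm_sw)
    \<comment> \<open>By linearity the sum of \<open>d (u \<otimes> v)\<close> over
      \<open>R (h \<otimes> l')\<close> is \<open>d\<close> of that tensor, to which
      \<open>D4\<close> applies.\<close>
    also have "\<dots> = dm (d (i l)) (dm (dm (d (j h)) (d (i l'))) (d (j h')))"
      using mem by (simp flip: d_sw add: sw_id D4)
    also have "\<dots> = dm (d (l \<otimes>\<^bsub>L,H\<^esub> h)) (d (l' \<otimes>\<^bsub>L,H\<^esub> h'))"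
      using mem by (simp only: D1[of l h] D1[of l' h'] dm_assoc[OF A] d_mem dm_mem)
    finally show ?thesis .
  qed
  have "d (m x y) = dm (d x) (d y)" if "x \<in> space LH" "y \<in> space LH" for x y
  proof -
    \<comment> \<open>Read backwards, this expands an element into pure tensors. Such a rule applies
      to its own result, so it is fixed to \<open>x\<close> and \<open>y\<close> and used at chosen
      occurrences.\<close>
    have [symmetric]: "sw L H LH t (\<lambda>a b. a \<otimes>\<^bsub>L,H\<^esub> b) = t" if "t \<in> space LH" for t
      using that by (simp add: sw_id)
    note expand = this[OF that(1)] this[OF that(2)]
    show ?thesis
      by (subst (1 2) expand(1), subst (1 2) expand(2)) (simp add: m_sw d_sw dm_sw pure)
  qed
  then show ?M by blast
qed

section \<open>The counit on products and the comultiplication of the unit\<close>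

lemma e_mult_iff:
  "(\<forall>x\<in>space LH. \<forall>y\<in>space LH. e (m x y) = e x * e y) \<longleftrightarrow>
   (\<forall>h\<in>space H. \<forall>l\<in>space L.
      sw L H ground (R (h \<otimes>\<^bsub>H,L\<^esub> l)) (\<lambda>Rl Rh. \<epsilon>\<^bsub>L\<^esub> Rl * \<epsilon>\<^bsub>H\<^esub> Rh) = \<epsilon>\<^bsub>H\<^esub> h * \<epsilon>\<^bsub>L\<^esub> l)"
proof
  assume *: "\<forall>x\<in>space LH. \<forall>y\<in>space LH. e (m x y) = e x * e y"
  show "\<forall>h\<in>space H. \<forall>l\<in>space L.
      sw L H ground (R (h \<otimes>\<^bsub>H,L\<^esub> l)) (\<lambda>Rl Rh. \<epsilon>\<^bsub>L\<^esub> Rl * \<epsilon>\<^bsub>H\<^esub> Rh) = \<epsilon>\<^bsub>H\<^esub> h * \<epsilon>\<^bsub>L\<^esub> l"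
  proof (intro ballI)
    fix h l assume hl: "h \<in> space H" "l \<in> space L"
    then have "e (m (j h) (i l)) = e (j h) * e (i l)" using * by simp
    with hl show "sw L H ground (R (h \<otimes>\<^bsub>H,L\<^esub> l)) (\<lambda>Rl Rh. \<epsilon>\<^bsub>L\<^esub> Rl * \<epsilon>\<^bsub>H\<^esub> Rh) = \<epsilon>\<^bsub>H\<^esub> h * \<epsilon>\<^bsub>L\<^esub> l"
      by (simp add: m_pure e_def sweedler_calc)
  qed
next
  assume *: "\<forall>h\<in>space H. \<forall>l\<in>space L.
      sw L H ground (R (h \<otimes>\<^bsub>H,L\<^esub> l)) (\<lambda>Rl Rh. \<epsilon>\<^bsub>L\<^esub> Rl * \<epsilon>\<^bsub>H\<^esub> Rh) = \<epsilon>\<^bsub>H\<^esub> h * \<epsilon>\<^bsub>L\<^esub> l"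
  have "e (m x y) = e x * e y" if "x \<in> space LH" "y \<in> space LH" for x y
  proof -
    \<comment> \<open>The counits of \<open>L\<close> and \<open>H\<close> are multiplicative, so
      those of \<open>l\<close> and \<open>h'\<close> split off, and between them the counits meet
      \<open>R\<close> in exactly the form of the assumption.\<close>
    have "e (m x y) = sw L H ground x (\<lambda>l h. sw L H ground y (\<lambda>l' h'.
      \<epsilon>\<^bsub>L\<^esub> l * (sw L H ground (R (h \<otimes>\<^bsub>H,L\<^esub> l')) (\<lambda>Rl Rh. \<epsilon>\<^bsub>L\<^esub> Rl * \<epsilon>\<^bsub>H\<^esub> Rh) * \<epsilon>\<^bsub>H\<^esub> h')))"
      by (simp add: m_def e_def sweedler_calc mult.assoc)
    also have "\<dots> = e x * e y"
      by (simp add: * cong: sw_cong) (subst sw_swap, simp add: e_def sw_pull_ground mult_ac)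
    finally show ?thesis .
  qed
  then show "\<forall>x\<in>space LH. \<forall>y\<in>space LH. e (m x y) = e x * e y" by blast
qed

text \<open>As both comultiplications preserve units, \<open>d one\<close> is \<open>W one\<close>
  between two outer units. Counits on the outer factors recover \<open>W one\<close>.\<close>

lemma d_one_iff:
  assumes c: "conormal H L W"
  shows "d one = one \<otimes>\<^bsub>LH,LH\<^esub> one \<longleftrightarrow> W one = \<one>\<^bsub>H\<^esub> \<otimes>\<^bsub>H,L\<^esub> \<one>\<^bsub>L\<^esub>"
proof
  assume "d one = one \<otimes>\<^bsub>LH,LH\<^esub> one"
  from arg_cong[OF this, of "\<lambda>t. sw LH LH HL t (\<lambda>a b. sw L H HL a (\<lambda>l1 h1. sw L H HL b (\<lambda>l2 h2.
      smul HL (\<epsilon>\<^bsub>L\<^esub> l1) (smul HL (\<epsilon>\<^bsub>H\<^esub> h2) (h1 \<otimes>\<^bsub>H,L\<^esub> l2)))))"]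
  show "W one = \<one>\<^bsub>H\<^esub> \<otimes>\<^bsub>H,L\<^esub> \<one>\<^bsub>L\<^esub>"
    by (simp add: d_pure sweedler_calc)
next
  assume "W one = \<one>\<^bsub>H\<^esub> \<otimes>\<^bsub>H,L\<^esub> \<one>\<^bsub>L\<^esub>"
  then show "d one = one \<otimes>\<^bsub>LH,LH\<^esub> one"
    by (simp add: d_pure sweedler_calc)
qed

section \<open>Compatibility on the four kinds of products of generators\<close>

lemma factor_iff:
  assumes n: "normal H L R" and c: "conormal H L W"
  shows "(\<forall>l\<in>space L. \<forall>h\<in>space H. d (l \<otimes>\<^bsub>L,H\<^esub> h) = dm (d (i l)) (d (j h))) \<longleftrightarrow>
    (\<forall>l\<in>space L. \<forall>h\<in>space H. W (l \<otimes>\<^bsub>L,H\<^esub> h) = sw H L HL (W (i l)) (\<lambda>a b. sw H L HL (W (j h)) (\<lambda>a' b'.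
       (a \<cdot>\<^bsub>H\<^esub> a') \<otimes>\<^bsub>H,L\<^esub> (b \<cdot>\<^bsub>L\<^esub> b'))))"
    (is "?D \<longleftrightarrow> ?W")
proof
  note R1 = normalD[OF n]
  { assume D: ?D
    show ?W
    proof (intro ballI)
      fix l h assume hl: "l \<in> space L" "h \<in> space H"
      with D have "d (l \<otimes>\<^bsub>L,H\<^esub> h) = dm (d (i l)) (d (j h))" by blast
      \<comment> \<open>The counits on the outer factors \<open>l1\<close> and \<open>h2\<close> cut
        the comultiplication down to its middle part, which is \<open>W\<close> on the left and the
        product of its two values on the right.\<close>
      from arg_cong[OF this, of "\<lambda>t. sw LH LH HL t (\<lambda>a b. sw L H HL a (\<lambda>l1 h1. sw L H HL b (\<lambda>l2 h2.
        smul HL (\<epsilon>\<^bsub>L\<^esub> l1) (smul HL (\<epsilon>\<^bsub>H\<^esub> h2) (h1 \<otimes>\<^bsub>H,L\<^esub> l2)))))"]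
      show "W (l \<otimes>\<^bsub>L,H\<^esub> h) = sw H L HL (W (i l)) (\<lambda>a b. sw H L HL (W (j h)) (\<lambda>a' b'.
       (a \<cdot>\<^bsub>H\<^esub> a') \<otimes>\<^bsub>H,L\<^esub> (b \<cdot>\<^bsub>L\<^esub> b')))"
        using hl by (simp add: d_pure dm_def m_pure R1 sweedler_calc counit_left counit_right)
    qed }
  assume W: ?W
  show ?D
  proof (intro ballI)
    fix l h assume hl: "l \<in> space L" "h \<in> space H"
    have "d (l \<otimes>\<^bsub>L,H\<^esub> h) = sw L L LH2 (\<Delta>\<^bsub>L\<^esub> l) (\<lambda>l1 l2. sw H H LH2 (\<Delta>\<^bsub>H\<^esub> h) (\<lambda>h1 h2.
      sw H L LH2 (sw H L HL (W (i l2)) (\<lambda>a b. sw H L HL (W (j h1)) (\<lambda>a' b'. (a \<cdot>\<^bsub>H\<^esub> a') \<otimes>\<^bsub>H,L\<^esub> (b \<cdot>\<^bsub>L\<^esub> b'))))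
        (\<lambda>Wh1 Wl2. (l1 \<otimes>\<^bsub>L,H\<^esub> Wh1) \<otimes>\<^bsub>LH,LH\<^esub> (Wl2 \<otimes>\<^bsub>L,H\<^esub> h2))))"
      unfolding d_pure[OF hl] by (intro sw_cong refl W[rule_format])
    \<comment> \<open>The inner units of \<open>d (i l)\<close> and \<open>d (j h)\<close> meet
      \<open>R\<close> in both halves, and normality removes it. So the product has the shape of
      \<open>d (l \<otimes> h)\<close>, with \<open>W (l2 \<otimes> h1)\<close> replaced by the
      product of \<open>W (i l2)\<close> and \<open>W (j h1)\<close>.\<close>
    also have "\<dots> = dm (d (i l)) (d (j h))"
      using hl by (simp add: d_pure dm_def m_pure R1 sweedler_calc) (rule sw_sort)+
    finally show "d (l \<otimes>\<^bsub>L,H\<^esub> h) = dm (d (i l)) (d (j h))" .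
  qed
qed

text \<open>Both sides end in the unit of \<open>H\<close>: \<open>d (i l)\<close> does, and
  normality preserves this under products. Removing that factor by a counit (\<open>?f\<close>) and
  putting it back (\<open>?g\<close>) are inverse to each other on such elements, so the
  three-factor identity loses nothing. The single \<open>R\<close> left over comes from the first
  halves.\<close>

lemma LL_iff:
  assumes n: "normal H L R"
  shows "(\<forall>l\<in>space L. \<forall>l'\<in>space L. d (i (l \<cdot>\<^bsub>L\<^esub> l')) = dm (d (i l)) (d (i l'))) \<longleftrightarrow>
    (\<forall>l\<in>space L. \<forall>l'\<in>space L.
      sw L L (L \<otimes>\<^sub>V H \<otimes>\<^sub>V L) (\<Delta>\<^bsub>L\<^esub> l) (\<lambda>l1 l2.
      sw L L (L \<otimes>\<^sub>V H \<otimes>\<^sub>V L) (\<Delta>\<^bsub>L\<^esub> l') (\<lambda>l1' l2'.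
      sw H L (L \<otimes>\<^sub>V H \<otimes>\<^sub>V L) (W ((l2 \<cdot>\<^bsub>L\<^esub> l2') \<otimes>\<^bsub>L,H\<^esub> \<one>\<^bsub>H\<^esub>)) (\<lambda>W1 Wll.
        pure\<^sub>3 L H L (l1 \<cdot>\<^bsub>L\<^esub> l1') W1 Wll))) =
      sw L L (L \<otimes>\<^sub>V H \<otimes>\<^sub>V L) (\<Delta>\<^bsub>L\<^esub> l) (\<lambda>l1 l2.
      sw L L (L \<otimes>\<^sub>V H \<otimes>\<^sub>V L) (\<Delta>\<^bsub>L\<^esub> l') (\<lambda>l1' l2'.
      sw H L (L \<otimes>\<^sub>V H \<otimes>\<^sub>V L) (W (l2 \<otimes>\<^bsub>L,H\<^esub> \<one>\<^bsub>H\<^esub>)) (\<lambda>W1 Wl2.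
      sw H L (L \<otimes>\<^sub>V H \<otimes>\<^sub>V L) (W (l2' \<otimes>\<^bsub>L,H\<^esub> \<one>\<^bsub>H\<^esub>)) (\<lambda>U1 Ul2'.
      sw L H (L \<otimes>\<^sub>V H \<otimes>\<^sub>V L) (R (W1 \<otimes>\<^bsub>H,L\<^esub> l1')) (\<lambda>Rl1' RW1.
        pure\<^sub>3 L H L (l1 \<cdot>\<^bsub>L\<^esub> Rl1') (RW1 \<cdot>\<^bsub>H\<^esub> U1) (Wl2 \<cdot>\<^bsub>L\<^esub> Ul2')))))))"
    (is "?D \<longleftrightarrow> (\<forall>l\<in>space L. \<forall>l'\<in>space L. ?X l l' = ?Y l l')")
proof -
  let ?V = "L \<otimes>\<^sub>V H \<otimes>\<^sub>V L"
  let ?f = "\<lambda>t. sw LH LH ?V t (\<lambda>a b. sw L H ?V a (\<lambda>l1 h1. sw L H ?V b (\<lambda>l2 h2.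
        smul ?V (\<epsilon>\<^bsub>H\<^esub> h2) (pure\<^sub>3 L H L l1 h1 l2))))"
  let ?g = "\<lambda>t. sw L HL LH2 t (\<lambda>l1 u. sw H L LH2 u (\<lambda>h1 l2. (l1 \<otimes>\<^bsub>L,H\<^esub> h1) \<otimes>\<^bsub>LH,LH\<^esub> i l2))"
  note R1 = normalD[OF n]
  have f: "?f (d (i (l \<cdot>\<^bsub>L\<^esub> l'))) = ?X l l'" "?f (dm (d (i l)) (d (i l'))) = ?Y l l'"
    and g: "?g (?X l l') = d (i (l \<cdot>\<^bsub>L\<^esub> l'))" "?g (?Y l l') = dm (d (i l)) (d (i l'))"
    if "l \<in> space L" "l' \<in> space L" for l l'
  proof -
    show "?f (d (i (l \<cdot>\<^bsub>L\<^esub> l'))) = ?X l l'"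
      using that by (simp add: d_pure pure_tensor3_def sweedler_calc)
    show "?g (?X l l') = d (i (l \<cdot>\<^bsub>L\<^esub> l'))"
      using that by (simp add: d_pure pure_tensor3_def sweedler_calc)
    show "?f (dm (d (i l)) (d (i l'))) = ?Y l l'"
      using that by (simp add: d_pure dm_def m_pure R1 pure_tensor3_def sweedler_calc) (rule sw_sort)+
    show "?g (?Y l l') = dm (d (i l)) (d (i l'))"
      using that by (simp add: d_pure dm_def m_pure R1 pure_tensor3_def sweedler_calc) (rule sw_sort)+
  qed
  have "d (i (l \<cdot>\<^bsub>L\<^esub> l')) = dm (d (i l)) (d (i l')) \<longleftrightarrow> ?X l l' = ?Y l l'" if "l \<in> space L" "l' \<in> space L" for l l'
    using f[OF that] g[OF that] by metis
  then show ?thesis by blast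
qed

text \<open>The mirror image of \<open>LL_iff\<close>: both sides begin with the unit of
  \<open>L\<close>, which \<open>?f\<close> removes and \<open>?g\<close> restores, and the
  \<open>R\<close> left over comes from the second halves.\<close>

lemma HH_iff:
  assumes n: "normal H L R"
  shows "(\<forall>h\<in>space H. \<forall>h'\<in>space H. d (j (h \<cdot>\<^bsub>H\<^esub> h')) = dm (d (j h)) (d (j h'))) \<longleftrightarrow>
    (\<forall>h\<in>space H. \<forall>h'\<in>space H.
      sw H H (H \<otimes>\<^sub>V L \<otimes>\<^sub>V H) (\<Delta>\<^bsub>H\<^esub> h) (\<lambda>h1 h2.
      sw H H (H \<otimes>\<^sub>V L \<otimes>\<^sub>V H) (\<Delta>\<^bsub>H\<^esub> h') (\<lambda>h1' h2'.
      sw H L (H \<otimes>\<^sub>V L \<otimes>\<^sub>V H) (W (\<one>\<^bsub>L\<^esub> \<otimes>\<^bsub>L,H\<^esub> (h1 \<cdot>\<^bsub>H\<^esub> h1'))) (\<lambda>Whh W1.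
        pure\<^sub>3 H L H Whh W1 (h2 \<cdot>\<^bsub>H\<^esub> h2')))) =
      sw H H (H \<otimes>\<^sub>V L \<otimes>\<^sub>V H) (\<Delta>\<^bsub>H\<^esub> h) (\<lambda>h1 h2.
      sw H H (H \<otimes>\<^sub>V L \<otimes>\<^sub>V H) (\<Delta>\<^bsub>H\<^esub> h') (\<lambda>h1' h2'.
      sw H L (H \<otimes>\<^sub>V L \<otimes>\<^sub>V H) (W (\<one>\<^bsub>L\<^esub> \<otimes>\<^bsub>L,H\<^esub> h1)) (\<lambda>Wh1 W1.
      sw H L (H \<otimes>\<^sub>V L \<otimes>\<^sub>V H) (W (\<one>\<^bsub>L\<^esub> \<otimes>\<^bsub>L,H\<^esub> h1')) (\<lambda>Uh1' U1.
      sw L H (H \<otimes>\<^sub>V L \<otimes>\<^sub>V H) (R (h2 \<otimes>\<^bsub>H,L\<^esub> U1)) (\<lambda>RU1 Rh2.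
        pure\<^sub>3 H L H (Wh1 \<cdot>\<^bsub>H\<^esub> Uh1') (W1 \<cdot>\<^bsub>L\<^esub> RU1) (Rh2 \<cdot>\<^bsub>H\<^esub> h2')))))))"
    (is "?D \<longleftrightarrow> (\<forall>h\<in>space H. \<forall>h'\<in>space H. ?X h h' = ?Y h h')")
proof -
  let ?V = "H \<otimes>\<^sub>V L \<otimes>\<^sub>V H"
  let ?f = "\<lambda>t. sw LH LH ?V t (\<lambda>a b. sw L H ?V a (\<lambda>l1 h1. sw L H ?V b (\<lambda>l2 h2.
        smul ?V (\<epsilon>\<^bsub>L\<^esub> l1) (pure\<^sub>3 H L H h1 l2 h2))))"
  let ?g = "\<lambda>t. sw H LH LH2 t (\<lambda>h1 u. sw L H LH2 u (\<lambda>l2 h2. j h1 \<otimes>\<^bsub>LH,LH\<^esub> (l2 \<otimes>\<^bsub>L,H\<^esub> h2)))"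
  note R1 = normalD[OF n]
  have f: "?f (d (j (h \<cdot>\<^bsub>H\<^esub> h'))) = ?X h h'" "?f (dm (d (j h)) (d (j h'))) = ?Y h h'"
    and g: "?g (?X h h') = d (j (h \<cdot>\<^bsub>H\<^esub> h'))" "?g (?Y h h') = dm (d (j h)) (d (j h'))"
    if "h \<in> space H" "h' \<in> space H" for h h'
  proof -
    show "?f (d (j (h \<cdot>\<^bsub>H\<^esub> h'))) = ?X h h'"
      using that by (simp add: d_pure pure_tensor3_def sweedler_calc)
    show "?g (?X h h') = d (j (h \<cdot>\<^bsub>H\<^esub> h'))"
      using that by (simp add: d_pure pure_tensor3_def sweedler_calc)
    show "?f (dm (d (j h)) (d (j h'))) = ?Y h h'"
      using that by (simp add: d_pure dm_def m_pure R1 pure_tensor3_def sweedler_calc) (rule sw_sort)+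
    show "?g (?Y h h') = dm (d (j h)) (d (j h'))"
      using that by (simp add: d_pure dm_def m_pure R1 pure_tensor3_def sweedler_calc) (rule sw_sort)+
  qed
  have "d (j (h \<cdot>\<^bsub>H\<^esub> h')) = dm (d (j h)) (d (j h')) \<longleftrightarrow> ?X h h' = ?Y h h'" if "h \<in> space H" "h' \<in> space H" for h h'
    using f[OF that] g[OF that] by metis
  then show ?thesis by blast
qed

text \<open>Here no factor is a unit throughout, and \<open>?f\<close>, \<open>?g\<close> only
  rebracket four factors. No \<open>R\<close> is removed by normality: the product of the first
  halves and that of the second halves each contribute one, hence the two copies in (DP8).\<close>

lemma HL_iff:
  assumes n: "normal H L R"
  shows "(\<forall>h\<in>space H. \<forall>l\<in>space L. d (R (h \<otimes>\<^bsub>H,L\<^esub> l)) = dm (d (j h)) (d (i l))) \<longleftrightarrow>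
    (\<forall>h\<in>space H. \<forall>l\<in>space L.
      sw L H (L \<otimes>\<^sub>V H \<otimes>\<^sub>V L \<otimes>\<^sub>V H) (R (h \<otimes>\<^bsub>H,L\<^esub> l)) (\<lambda>Rl Rh.
      sw L L (L \<otimes>\<^sub>V H \<otimes>\<^sub>V L \<otimes>\<^sub>V H) (\<Delta>\<^bsub>L\<^esub> Rl) (\<lambda>Rl1 Rl2.
      sw H H (L \<otimes>\<^sub>V H \<otimes>\<^sub>V L \<otimes>\<^sub>V H) (\<Delta>\<^bsub>H\<^esub> Rh) (\<lambda>Rh1 Rh2.
      sw H L (L \<otimes>\<^sub>V H \<otimes>\<^sub>V L \<otimes>\<^sub>V H) (W (Rl2 \<otimes>\<^bsub>L,H\<^esub> Rh1)) (\<lambda>WRh1 WRl2.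
        pure\<^sub>4 L H L H Rl1 WRh1 WRl2 Rh2)))) =
      sw L L (L \<otimes>\<^sub>V H \<otimes>\<^sub>V L \<otimes>\<^sub>V H) (\<Delta>\<^bsub>L\<^esub> l) (\<lambda>l1 l2.
      sw H H (L \<otimes>\<^sub>V H \<otimes>\<^sub>V L \<otimes>\<^sub>V H) (\<Delta>\<^bsub>H\<^esub> h) (\<lambda>h1 h2.
      sw H L (L \<otimes>\<^sub>V H \<otimes>\<^sub>V L \<otimes>\<^sub>V H) (W (\<one>\<^bsub>L\<^esub> \<otimes>\<^bsub>L,H\<^esub> h1)) (\<lambda>Wh1 W1.
      sw H L (L \<otimes>\<^sub>V H \<otimes>\<^sub>V L \<otimes>\<^sub>V H) (W (l2 \<otimes>\<^bsub>L,H\<^esub> \<one>\<^bsub>H\<^esub>)) (\<lambda>U1 Ul2.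
      sw L H (L \<otimes>\<^sub>V H \<otimes>\<^sub>V L \<otimes>\<^sub>V H) (R (Wh1 \<otimes>\<^bsub>H,L\<^esub> l1)) (\<lambda>Rl1 RWh1.
      sw L H (L \<otimes>\<^sub>V H \<otimes>\<^sub>V L \<otimes>\<^sub>V H) (R (h2 \<otimes>\<^bsub>H,L\<^esub> Ul2)) (\<lambda>rUl2 rh2.
        pure\<^sub>4 L H L H Rl1 (RWh1 \<cdot>\<^bsub>H\<^esub> U1) (W1 \<cdot>\<^bsub>L\<^esub> rUl2) rh2)))))))"
    (is "?D \<longleftrightarrow> (\<forall>h\<in>space H. \<forall>l\<in>space L. ?X h l = ?Y h l)")
proof -
  let ?V = "L \<otimes>\<^sub>V H \<otimes>\<^sub>V L \<otimes>\<^sub>V H"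
  let ?f = "\<lambda>t. sw LH LH ?V t (\<lambda>a b. sw L H ?V a (\<lambda>l1 h1. l1 \<otimes>\<^bsub>L,H \<otimes>\<^sub>V LH\<^esub> (h1 \<otimes>\<^bsub>H,LH\<^esub> b)))"
  let ?g = "\<lambda>t. sw L (H \<otimes>\<^sub>V LH) LH2 t (\<lambda>l1 u. sw H LH LH2 u (\<lambda>h1 v. (l1 \<otimes>\<^bsub>L,H\<^esub> h1) \<otimes>\<^bsub>LH,LH\<^esub> v))"
  note R1 = normalD[OF n]
  have f: "?f (d (R (h \<otimes>\<^bsub>H,L\<^esub> l))) = ?X h l" "?f (dm (d (j h)) (d (i l))) = ?Y h l"
    and g: "?g (?X h l) = d (R (h \<otimes>\<^bsub>H,L\<^esub> l))" "?g (?Y h l) = dm (d (j h)) (d (i l))"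
    if "h \<in> space H" "l \<in> space L" for h l
  proof -
    show "?f (d (R (h \<otimes>\<^bsub>H,L\<^esub> l))) = ?X h l"
      using that by (simp add: d_def pure_tensor3_def pure_tensor4_def sweedler_calc)
    show "?g (?X h l) = d (R (h \<otimes>\<^bsub>H,L\<^esub> l))"
      using that by (simp add: d_def pure_tensor3_def pure_tensor4_def sweedler_calc)
    show "?f (dm (d (j h)) (d (i l))) = ?Y h l"
      using that by (simp add: d_pure dm_def m_pure R1 pure_tensor3_def pure_tensor4_def sweedler_calc) (rule sw_sort)+
    show "?g (?Y h l) = dm (d (j h)) (d (i l))"
      using that by (simp add: d_pure dm_def m_pure R1 pure_tensor3_def pure_tensor4_def sweedler_calc) (rule sw_sort)+
  qed
  have "d (R (h \<otimes>\<^bsub>H,L\<^esub> l)) = dm (d (j h)) (d (i l)) \<longleftrightarrow> ?X h l = ?Y h l" if "h \<in> space H" "l \<in> space L" for h l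
    using f[OF that] g[OF that] by metis
  then show ?thesis by blast
qed

section \<open>Assembling the equivalence\<close>

lemma smash_biproduct_iff_generators: "smash_biproduct L H W R \<longleftrightarrow>
    (normal H L R \<and> multiplicative H L R) \<and> (conormal H L W \<and> comultiplicative H L W) \<and>
    (\<forall>x\<in>space LH. \<forall>y\<in>space LH. e (m x y) = e x * e y) \<and>
    W one = \<one>\<^bsub>H\<^esub> \<otimes>\<^bsub>H,L\<^esub> \<one>\<^bsub>L\<^esub> \<and>
    (\<forall>l\<in>space L. \<forall>h\<in>space H. d (l \<otimes>\<^bsub>L,H\<^esub> h) = dm (d (i l)) (d (j h))) \<and>
    (\<forall>l\<in>space L. \<forall>l'\<in>space L. d (i (l \<cdot>\<^bsub>L\<^esub> l')) = dm (d (i l)) (d (i l'))) \<and>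
    (\<forall>h\<in>space H. \<forall>h'\<in>space H. d (j (h \<cdot>\<^bsub>H\<^esub> h')) = dm (d (j h)) (d (j h'))) \<and>
    (\<forall>h\<in>space H. \<forall>l\<in>space L. d (R (h \<otimes>\<^bsub>H,L\<^esub> l)) = dm (d (j h)) (d (i l)))"
proof (cases "algebra A \<and> coalgebra A")
  case True
  then have "algebra A" "coalgebra A"
    and *: "normal H L R" "multiplicative H L R" "conormal H L W" "comultiplicative H L W"
    by (simp_all only: algebra_iff coalgebra_iff)
  then show ?thesis
    unfolding smash_biproduct_iff d_mult_iff[OF \<open>algebra A\<close>] d_one_iff[OF *(3)] by argo
next
  \<comment> \<open>The reductions \<open>d_mult_iff\<close> and \<open>d_one_iff\<close> presuppose
    the algebra and conormality. If the algebra or coalgebra structure fails, both sides of the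
    equivalence are false.\<close>
  case False
  then show ?thesis
    unfolding smash_biproduct_iff algebra_iff coalgebra_iff by blast
qed

end

theorem theorem4p6:
  fixes H :: "('k::field, 'h::ab_group_add) bialg_data"
    and L :: "('k, 'l::ab_group_add) bialg_data"
    and R :: "('k, 'h, 'l) tensor \<Rightarrow> ('k, 'l, 'h) tensor"
    and W :: "('k, 'l, 'h) tensor \<Rightarrow> ('k, 'h, 'l) tensor"
  assumes "bialgebra H" and "bialgebra L"
    and "linear_map (H \<otimes>\<^sub>V L) (L \<otimes>\<^sub>V H) R"
    and "linear_map (L \<otimes>\<^sub>V H) (H \<otimes>\<^sub>V L) W"
  shows "smash_biproduct L H W R \<longleftrightarrow>
    (normal H L R \<and> multiplicative H L R) \<and>
    (conormal H L W \<and> comultiplicative H L W) \<and>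
    (\<forall>h\<in>space H. \<forall>l\<in>space L.
      sweedler L H (R (h \<otimes>\<^bsub>H,L\<^esub> l)) (\<lambda>Rl Rh. \<epsilon>\<^bsub>L\<^esub> Rl * \<epsilon>\<^bsub>H\<^esub> Rh) = \<epsilon>\<^bsub>H\<^esub> h * \<epsilon>\<^bsub>L\<^esub> l) \<and>
    W (\<one>\<^bsub>L\<^esub> \<otimes>\<^bsub>L,H\<^esub> \<one>\<^bsub>H\<^esub>) = \<one>\<^bsub>H\<^esub> \<otimes>\<^bsub>H,L\<^esub> \<one>\<^bsub>L\<^esub> \<and>
    (\<forall>l\<in>space L. \<forall>h\<in>space H.
      W (l \<otimes>\<^bsub>L,H\<^esub> h) = tensor_mul H L (W (l \<otimes>\<^bsub>L,H\<^esub> \<one>\<^bsub>H\<^esub>)) (W (\<one>\<^bsub>L\<^esub> \<otimes>\<^bsub>L,H\<^esub> h))) \<and>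
    (\<forall>l\<in>space L. \<forall>l'\<in>space L.
      sweedler L L (\<Delta>\<^bsub>L\<^esub> l) (\<lambda>l1 l2.
      sweedler L L (\<Delta>\<^bsub>L\<^esub> l') (\<lambda>l1' l2'.
      sweedler H L (W ((l2 \<cdot>\<^bsub>L\<^esub> l2') \<otimes>\<^bsub>L,H\<^esub> \<one>\<^bsub>H\<^esub>)) (\<lambda>W1 Wll.
        pure\<^sub>3 L H L (l1 \<cdot>\<^bsub>L\<^esub> l1') W1 Wll))) =
      sweedler L L (\<Delta>\<^bsub>L\<^esub> l) (\<lambda>l1 l2.
      sweedler L L (\<Delta>\<^bsub>L\<^esub> l') (\<lambda>l1' l2'.
      sweedler H L (W (l2 \<otimes>\<^bsub>L,H\<^esub> \<one>\<^bsub>H\<^esub>)) (\<lambda>W1 Wl2.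
      sweedler H L (W (l2' \<otimes>\<^bsub>L,H\<^esub> \<one>\<^bsub>H\<^esub>)) (\<lambda>U1 Ul2'.
      sweedler L H (R (W1 \<otimes>\<^bsub>H,L\<^esub> l1')) (\<lambda>Rl1' RW1.
        pure\<^sub>3 L H L (l1 \<cdot>\<^bsub>L\<^esub> Rl1') (RW1 \<cdot>\<^bsub>H\<^esub> U1) (Wl2 \<cdot>\<^bsub>L\<^esub> Ul2'))))))) \<and>
    (\<forall>h\<in>space H. \<forall>h'\<in>space H.
      sweedler H H (\<Delta>\<^bsub>H\<^esub> h) (\<lambda>h1 h2.
      sweedler H H (\<Delta>\<^bsub>H\<^esub> h') (\<lambda>h1' h2'.
      sweedler H L (W (\<one>\<^bsub>L\<^esub> \<otimes>\<^bsub>L,H\<^esub> (h1 \<cdot>\<^bsub>H\<^esub> h1'))) (\<lambda>Whh W1.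
        pure\<^sub>3 H L H Whh W1 (h2 \<cdot>\<^bsub>H\<^esub> h2')))) =
      sweedler H H (\<Delta>\<^bsub>H\<^esub> h) (\<lambda>h1 h2.
      sweedler H H (\<Delta>\<^bsub>H\<^esub> h') (\<lambda>h1' h2'.
      sweedler H L (W (\<one>\<^bsub>L\<^esub> \<otimes>\<^bsub>L,H\<^esub> h1)) (\<lambda>Wh1 W1.
      sweedler H L (W (\<one>\<^bsub>L\<^esub> \<otimes>\<^bsub>L,H\<^esub> h1')) (\<lambda>Uh1' U1.
      sweedler L H (R (h2 \<otimes>\<^bsub>H,L\<^esub> U1)) (\<lambda>RU1 Rh2.
        pure\<^sub>3 H L H (Wh1 \<cdot>\<^bsub>H\<^esub> Uh1') (W1 \<cdot>\<^bsub>L\<^esub> RU1) (Rh2 \<cdot>\<^bsub>H\<^esub> h2'))))))) \<and>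
    (\<forall>h\<in>space H. \<forall>l\<in>space L.
      sweedler L H (R (h \<otimes>\<^bsub>H,L\<^esub> l)) (\<lambda>Rl Rh.
      sweedler L L (\<Delta>\<^bsub>L\<^esub> Rl) (\<lambda>Rl1 Rl2.
      sweedler H H (\<Delta>\<^bsub>H\<^esub> Rh) (\<lambda>Rh1 Rh2.
      sweedler H L (W (Rl2 \<otimes>\<^bsub>L,H\<^esub> Rh1)) (\<lambda>WRh1 WRl2.
        pure\<^sub>4 L H L H Rl1 WRh1 WRl2 Rh2)))) =
      sweedler L L (\<Delta>\<^bsub>L\<^esub> l) (\<lambda>l1 l2.
      sweedler H H (\<Delta>\<^bsub>H\<^esub> h) (\<lambda>h1 h2.
      sweedler H L (W (\<one>\<^bsub>L\<^esub> \<otimes>\<^bsub>L,H\<^esub> h1)) (\<lambda>Wh1 W1.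
      sweedler H L (W (l2 \<otimes>\<^bsub>L,H\<^esub> \<one>\<^bsub>H\<^esub>)) (\<lambda>U1 Ul2.
      sweedler L H (R (Wh1 \<otimes>\<^bsub>H,L\<^esub> l1)) (\<lambda>Rl1 RWh1.
      sweedler L H (R (h2 \<otimes>\<^bsub>H,L\<^esub> Ul2)) (\<lambda>rUl2 rh2.
        pure\<^sub>4 L H L H Rl1 (RWh1 \<cdot>\<^bsub>H\<^esub> U1) (W1 \<cdot>\<^bsub>L\<^esub> rUl2) rh2)))))))"
proof -
  interpret smash_data H L R W
    using assms by unfold_locales
  show ?thesis
    unfolding smash_biproduct_iff_generators
  \<comment> \<open>\<open>conj_cong\<close> supplies the earlier conjuncts when a later pair is
    compared; normality and conormality, on which the translations of (DP5) to (DP8) rest, are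
    obtained in this way.\<close>
  proof (intro conj_cong refl, goal_cases)
    case 1
    show ?case
      unfolding e_mult_iff by (intro ball_cong refl) (simp add: sweedler_sw_types)
  next
    case 2
    then have "normal H L R" "conormal H L W" by blast+
    from factor_iff[OF this] show ?case
      by (rule trans) (intro ball_cong refl, simp add: tensor_mul_def sweedler_sw_types)
  next
    case 3
    then have "normal H L R" by blast
    from LL_iff[OF this] show ?case
      by (rule trans) (intro ball_cong refl, simp add: sweedler_sw_types pure3_mem)
  next
    case 4
    then have "normal H L R" by blast
    from HH_iff[OF this] show ?case
      by (rule trans) (intro ball_cong refl, simp add: sweedler_sw_types pure3_mem)
  next
    case 5
    then have "normal H L R" by blast
    from HL_iff[OF this] show ?case
      by (rule trans) (intro ball_cong refl, simp add: sweedler_sw_types)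
  qed
qed

end
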